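(* Let $F$ be a local field with ring of integers $\mathfrak{o}$, maximal ideal $\mathfrak{p}$ and finite residue field $\mathbb{F}_q$, and let $\mathfrak{o}_2=\mathfrak{o}/\mathfrak{p}^2$. Then there exist irreducible representations of $G=\mathrm{GL}_4(\mathfrak{o}_2)$ which are cuspidal but not strongly cuspidal, that is, cuspidal irreducible representations whose orbit in $M_4(\mathbb{F}_q)$ does not consist of matrices with irreducible characteristic polynomial.
   Context: All representations are finite-dimensional and complex. $F$ is an arbitrary (non-archimedean) local field, $G=\mathrm{GL}_4(\mathfrak{o}_2)$, and $K_1$ is the kernel of the reduction map $G\to \mathrm{GL}_4(\mathbb{F}_q)$. Orbit. Fix an additive character $\psi$ of $\mathfrak{o}$ with conductor $\mathfrak{p}^2$ (trivial on $\mathfrak{p}^2$, non-trivial on $\mathfrak{p}$). For $\beta\in M_4(\mathbb{F}_q)$ define the character $\psi_\beta:K_1\to\mathbb{C}^\times$ by $\psi_\beta(x)=\psi(\mathrm{Tr}(\beta(x-1)))$ (computed with any lift of $\beta$ to $M_4(\mathfrak{o}_2)$). Every character of the abelian group $K_1$ is of this form for a unique $\beta$. For an irreducible representation $\pi$ of $G$, the set of $\beta$ such that $\psi_\beta$ occurs in $\pi|_{K_1}$ is a single $\mathrm{GL}_4(\mathbb{F}_q)$-conjugacy class in $M_4(\mathbb{F}_q)$, called the orbit of $\pi$. The representation $\pi$ is called strongly cuspidal if the matrices in its orbit have irreducible characteristic polynomial over $\mathbb{F}_q$. Geometric induction. For $(i,j)\in\{(1,3),(2,2),(3,1)\}$,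 let $U_{i,j}\subset G$ be the group of block matrices $\begin{pmatrix} I_i & *\\ 0& I_j\end{pmatrix}$ over $\mathfrak{o}_2$. Infinitesimal induction. For each partition $\lambda\in\{(2,1^3),(2^2,1^2),(2^3,1)\}$, let $M_\lambda=\bigoplus_i \mathfrak{o}/\mathfrak{p}^{\lambda_i}$, embedded as a submodule of $\mathfrak{o}_2^4$; let $P_{\lambda\hookrightarrow 2^4}$ be the stabilizer of this submodule in $G$, and let $U_{\lambda\hookrightarrow 2^4}$ be the kernel of the natural map $P_{\lambda\hookrightarrow 2^4}\to \mathrm{Aut}_{\mathfrak{o}}(M_\lambda)$ given by restriction. Cuspidality. An irreducible representation $\pi$ of $G$ is cuspidal if for every character $\chi:\mathfrak{o}_2^\times\to\mathbb{C}^\times$ the twist $\pi\otimes(\chi\circ\det)$ has no non-zero vector fixed by any of the groups $U_{i,j}$ or $U_{\lambda\hookrightarrow 2^4}$ above. *)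

theory Defs
  imports "Jordan_Normal_Form.Char_Poly" "Jordan_Normal_Form.VS_Connect"
    "HOL-Algebra.Coset"
begin

section \<open>Non-archimedean local fields\<close>

text \<open>The value of \<open>val\<close> at \<open>0\<close> is irrelevant; \<open>val_ge\<close> treats it as infinite.\<close>

class valued_field = field +
  fixes val :: "'a \<Rightarrow> int"
  assumes val_mult: "x \<noteq> 0 \<Longrightarrow> y \<noteq> 0 \<Longrightarrow> val (x * y) = val x + val y"
    and val_add: "x \<noteq> 0 \<Longrightarrow> y \<noteq> 0 \<Longrightarrow> x + y \<noteq> 0 \<Longrightarrow> min (val x) (val y) \<le> val (x + y)"
    and val_normalised: "\<exists>x. x \<noteq> 0 \<and> val x = 1"
begin

definition val_ge :: "int \<Rightarrow> 'a \<Rightarrow> bool" where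
  "val_ge k x \<longleftrightarrow> x = 0 \<or> k \<le> val x"

lemma val_ge_0 [simp]: "val_ge k 0"
  by (simp add: val_ge_def)

lemma val_1 [simp]: "val 1 = 0"
  using val_mult[of 1 1] by simp

lemma val_minus [simp]: "val (- x) = val x"
proof (cases "x = 0")
  case False
  have "val ((-1) * (-1)) = val (-1) + val (-1)"
    by (rule val_mult) auto
  hence "val (-1) = 0"
    by simp
  with val_mult[of "-1" x] False show ?thesis
    by simp
qed simp

lemma val_ge_add: "val_ge k x \<Longrightarrow> val_ge k y \<Longrightarrow> val_ge k (x + y)"
  using val_add[of x y] by (cases "x = 0 \<or> y = 0 \<or> x + y = 0") (auto simp: val_ge_def)

lemma val_ge_minus: "val_ge k x \<Longrightarrow> val_ge k (- x)"
  by (auto simp: val_ge_def)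

lemma val_ge_diff: "val_ge k x \<Longrightarrow> val_ge k y \<Longrightarrow> val_ge k (x - y)"
  using val_ge_add[of k x "- y"] val_ge_minus[of k y] by simp

lemma val_ge_mult: "val_ge k x \<Longrightarrow> val_ge l y \<Longrightarrow> val_ge (k + l) (x * y)"
  using val_mult[of x y] by (cases "x = 0 \<or> y = 0") (auto simp: val_ge_def)

lemma val_ge_mono: "val_ge k x \<Longrightarrow> l \<le> k \<Longrightarrow> val_ge l x"
  by (auto simp: val_ge_def)

lemma val_inverse: "x \<noteq> 0 \<Longrightarrow> val (inverse x) = - val x"
  using val_mult[of x "inverse x"] by simp

end

class nonarch_local_field = valued_field +
  assumes complete:
    "(\<And>k. \<exists>N. \<forall>m\<ge>N. \<forall>n\<ge>N. val_ge k (X m - X n)) \<Longrightarrow>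
      \<exists>L. \<forall>k. \<exists>N. \<forall>n\<ge>N. val_ge k (X (n::nat) - L)"
  and finite_residue:
    "finite ({x. val_ge 0 x} // {(x, y). val_ge 0 x \<and> val_ge 0 y \<and> val_ge 1 (x - y)})"


section \<open>The ring of integers, its quotient by \<open>\<pp>\<^sup>2\<close>, and the residue field\<close>

typedef (overloaded) 'a intring = "{x :: 'a :: nonarch_local_field. val_ge 0 x}"
  by (rule exI[of _ 0]) simp

setup_lifting type_definition_intring

instantiation intring :: (nonarch_local_field) idom
begin

lift_definition zero_intring :: "'a intring" is 0 by simp
lift_definition one_intring :: "'a intring" is 1 by (simp add: val_ge_def)
lift_definition plus_intring :: "'a intring \<Rightarrow> 'a intring \<Rightarrow> 'a intring" is "(+)"
  by (rule val_ge_add)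
lift_definition minus_intring :: "'a intring \<Rightarrow> 'a intring \<Rightarrow> 'a intring" is "(-)"
  by (rule val_ge_diff)
lift_definition uminus_intring :: "'a intring \<Rightarrow> 'a intring" is uminus
  by (rule val_ge_minus)
lift_definition times_intring :: "'a intring \<Rightarrow> 'a intring \<Rightarrow> 'a intring" is "(*)"
  using val_ge_mult[of 0 _ 0] by simp

instance
  by standard (transfer; simp add: algebra_simps)+

end

text \<open>The \<open>k\<close>-th power of the maximal ideal \<open>\<pp>\<close>; \<open>pideal_1\<close> and \<open>pideal_2\<close> below
  identify \<open>pideal 1\<close> with the set of non-units and \<open>pideal 2\<close> with its square.\<close>

definition pideal :: "nat \<Rightarrow> 'a :: nonarch_local_field intring set" where
  "pideal k = {x. val_ge (int k) (Rep_intring x)}"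

lemma pideal_0 [simp]: "0 \<in> pideal k"
  by (simp add: pideal_def zero_intring.rep_eq)

lemma pideal_eq: "x = y \<Longrightarrow> x - y \<in> pideal k"
  by simp

lemma pideal_add: "x \<in> pideal k \<Longrightarrow> y \<in> pideal k \<Longrightarrow> x + y \<in> pideal k"
  by (simp add: pideal_def plus_intring.rep_eq val_ge_add)

lemma pideal_minus: "x \<in> pideal k \<Longrightarrow> - x \<in> pideal k"
  by (simp add: pideal_def uminus_intring.rep_eq val_ge_minus)

lemma pideal_mult: "x \<in> pideal k \<Longrightarrow> y * x \<in> pideal k"
  using Rep_intring[of y] val_ge_mult[of 0 "Rep_intring y" "int k" "Rep_intring x"]
  by (simp add: pideal_def times_intring.rep_eq)

lemma pideal_mono: "x \<in> pideal k \<Longrightarrow> l \<le> k \<Longrightarrow> x \<in> pideal l"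
  by (auto simp: pideal_def intro: val_ge_mono)

lemma one_notin_pideal: "k > 0 \<Longrightarrow> 1 \<notin> pideal k"
  by (simp add: pideal_def one_intring.rep_eq val_ge_def)

lemma unit_if_notin_pideal:
  fixes x :: "'a :: nonarch_local_field intring"
  assumes "x \<notin> pideal 1"
  obtains y where "x * y = 1"
proof -
  let ?r = "Rep_intring x"
  have *: "?r \<noteq> 0" "val ?r = 0"
    using assms Rep_intring[of x] by (auto simp: pideal_def val_ge_def)
  hence "val_ge 0 (inverse ?r)"
    by (simp add: val_ge_def val_inverse)
  hence "x * Abs_intring (inverse ?r) = 1"
    using * by (simp add: Rep_intring_inject [symmetric] times_intring.rep_eq
        one_intring.rep_eq Abs_intring_inverse)
  thus ?thesis by (rule that)
qed

lemma pideal_1: "pideal 1 = {x :: 'a :: nonarch_local_field intring. \<not> x dvd 1}"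
proof -
  have "\<not> x dvd 1" if "x \<in> pideal 1" for x :: "'a intring"
  proof
    assume "x dvd 1"
    then obtain y where "1 = x * y"
      by (rule dvdE)
    hence "1 = y * x"
      by (simp only: mult.commute)
    hence "(1 :: 'a intring) \<in> pideal 1"
      using pideal_mult[OF that, of y] by (simp only:)
    thus False
      using one_notin_pideal[of 1, where ?'a = 'a] by simp
  qed
  moreover have "x dvd 1" if x: "x \<notin> pideal 1" for x :: "'a intring"
  proof -
    obtain y where "x * y = 1"
      by (rule unit_if_notin_pideal[OF x])
    thus ?thesis
      by (intro dvdI[of _ _ y]) (rule sym)
  qed
  ultimately show ?thesis by blast
qed

lemma pideal_2:
  "pideal 2 = {x * y | x y :: 'a :: nonarch_local_field intring. x \<in> pideal 1 \<and> y \<in> pideal 1}"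
proof (intro Set.set_eqI iffI)
  fix z :: "'a intring"
  assume z: "z \<in> pideal 2"
  obtain w :: 'a where w: "w \<noteq> 0" "val w = 1"
    using val_normalised by blast
  have w1: "val_ge 0 w" "val_ge 1 w"
    using w by (auto simp: val_ge_def)
  have "val_ge (2 + (-1)) (Rep_intring z * inverse w)"
    using z w by (intro val_ge_mult) (auto simp: pideal_def val_ge_def val_inverse)
  hence q: "val_ge 1 (Rep_intring z * inverse w)"
    by simp
  hence q0: "val_ge 0 (Rep_intring z * inverse w)"
    by (rule val_ge_mono) simp
  have "z = Abs_intring w * Abs_intring (Rep_intring z * inverse w)"
    using w w1 q0 by (simp add: Rep_intring_inject [symmetric] times_intring.rep_eq
        Abs_intring_inverse)
  moreover have "Abs_intring w \<in> pideal 1" "Abs_intring (Rep_intring z * inverse w) \<in> pideal 1"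
    using w1 q q0 by (simp_all add: pideal_def Abs_intring_inverse)
  ultimately show "z \<in> {x * y | x y. x \<in> pideal 1 \<and> y \<in> pideal 1}"
    by blast
next
  fix z :: "'a intring"
  assume "z \<in> {x * y | x y. x \<in> pideal 1 \<and> y \<in> pideal 1}"
  then obtain x y where "z = x * y" "x \<in> pideal 1" "y \<in> pideal 1"
    by blast
  thus "z \<in> pideal 2"
    using val_ge_mult[of 1 "Rep_intring x" 1 "Rep_intring y"]
    by (simp add: pideal_def times_intring.rep_eq)
qed

lemma pideal_equivp: "equivp (\<lambda>x y. x - y \<in> pideal k)"
proof (rule equivpI)
  show "reflp (\<lambda>x y. x - y \<in> pideal k)"
    by (rule reflpI) simp
  show "symp (\<lambda>x y. x - y \<in> pideal k)"
    by (rule sympI) (metis pideal_minus minus_diff_eq)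
  show "transp (\<lambda>x y. x - y \<in> pideal k)"
    by (rule transpI) (metis pideal_add diff_add_cancel add_diff_eq)
qed

lemma pideal_cong_add:
  "a - b \<in> pideal k \<Longrightarrow> c - d \<in> pideal k \<Longrightarrow> (a + c) - (b + d) \<in> pideal k"
  using pideal_add[of "a - b" k "c - d"] by (simp add: algebra_simps)

lemma pideal_cong_minus: "a - b \<in> pideal k \<Longrightarrow> - a - - b \<in> pideal k"
  using pideal_minus[of "a - b" k] by (simp add: algebra_simps)

lemma pideal_cong_diff:
  "a - b \<in> pideal k \<Longrightarrow> c - d \<in> pideal k \<Longrightarrow> (a - c) - (b - d) \<in> pideal k"
  using pideal_cong_add[OF _ pideal_cong_minus, of a b k c d] by simp

lemma pideal_cong_mult:
  "a - b \<in> pideal k \<Longrightarrow> c - d \<in> pideal k \<Longrightarrow> a * c - b * d \<in> pideal k"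
  using pideal_add[OF pideal_mult[of "a - b" k c] pideal_mult[of "c - d" k b]]
  by (simp add: algebra_simps)

quotient_type (overloaded) 'a intring2 =
  "'a :: nonarch_local_field intring" / "\<lambda>x y. x - y \<in> pideal 2"
  by (rule pideal_equivp)

quotient_type (overloaded) 'a resfield =
  "'a :: nonarch_local_field intring" / "\<lambda>x y. x - y \<in> pideal 1"
  by (rule pideal_equivp)

instantiation intring2 :: (nonarch_local_field) comm_ring_1
begin

lift_definition zero_intring2 :: "'a intring2" is 0 .
lift_definition one_intring2 :: "'a intring2" is 1 .
lift_definition plus_intring2 :: "'a intring2 \<Rightarrow> 'a intring2 \<Rightarrow> 'a intring2" is "(+)"
  by (rule pideal_cong_add)
lift_definition minus_intring2 :: "'a intring2 \<Rightarrow> 'a intring2 \<Rightarrow> 'a intring2" is "(-)"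
  by (rule pideal_cong_diff)
lift_definition uminus_intring2 :: "'a intring2 \<Rightarrow> 'a intring2" is uminus
  by (rule pideal_cong_minus)
lift_definition times_intring2 :: "'a intring2 \<Rightarrow> 'a intring2 \<Rightarrow> 'a intring2" is "(*)"
  by (rule pideal_cong_mult)

instance
proof
  show "(0 :: 'a intring2) \<noteq> 1"
    by transfer (use pideal_minus[of "- 1" 2] one_notin_pideal[of 2] in auto)
qed (transfer, rule pideal_eq, simp add: algebra_simps)+

end

instantiation resfield :: (nonarch_local_field) comm_ring_1
begin

lift_definition zero_resfield :: "'a resfield" is 0 .
lift_definition one_resfield :: "'a resfield" is 1 .
lift_definition plus_resfield :: "'a resfield \<Rightarrow> 'a resfield \<Rightarrow> 'a resfield" is "(+)"
  by (rule pideal_cong_add)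
lift_definition minus_resfield :: "'a resfield \<Rightarrow> 'a resfield \<Rightarrow> 'a resfield" is "(-)"
  by (rule pideal_cong_diff)
lift_definition uminus_resfield :: "'a resfield \<Rightarrow> 'a resfield" is uminus
  by (rule pideal_cong_minus)
lift_definition times_resfield :: "'a resfield \<Rightarrow> 'a resfield \<Rightarrow> 'a resfield" is "(*)"
  by (rule pideal_cong_mult)

instance
proof
  show "(0 :: 'a resfield) \<noteq> 1"
    by transfer (use pideal_minus[of "- 1" 1] one_notin_pideal[of 1] in auto)
qed (transfer, rule pideal_eq, simp add: algebra_simps)+

end

lemma resfield_ex_inverse:
  fixes x :: "'a :: nonarch_local_field resfield"
  shows "x \<noteq> 0 \<Longrightarrow> \<exists>y. x * y = 1"
proof (transfer, goal_cases)
  case (1 x)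
  then obtain y where "x * y = 1"
    using unit_if_notin_pideal[of x] by auto
  thus ?case by (intro exI[of _ y]) simp
qed

instantiation resfield :: (nonarch_local_field) field
begin

definition inverse_resfield :: "'a resfield \<Rightarrow> 'a resfield" where
  "inverse_resfield x = (if x = 0 then 0 else (SOME y. x * y = 1))"

definition divide_resfield :: "'a resfield \<Rightarrow> 'a resfield \<Rightarrow> 'a resfield" where
  "divide_resfield x y = x * inverse y"

instance
proof
  fix x y :: "'a resfield"
  show "inverse x * x = 1" if "x \<noteq> 0"
  proof -
    have "x * inverse x = 1"
      unfolding inverse_resfield_def if_not_P[OF that]
      by (rule someI_ex[OF resfield_ex_inverse[OF that]])
    thus ?thesis by (simp only: mult.commute)
  qed
  show "x div y = x * inverse y"
    by (rule divide_resfield_def)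
  show "inverse (0 :: 'a resfield) = 0"
    by (simp add: inverse_resfield_def)
qed

end

definition to_intring2 :: "'a :: nonarch_local_field intring \<Rightarrow> 'a intring2" where
  "to_intring2 = abs_intring2"

lift_definition reduce :: "'a :: nonarch_local_field intring2 \<Rightarrow> 'a resfield" is "\<lambda>x. x"
  by (erule pideal_mono) simp


section \<open>General linear groups and complex representations\<close>

definition GL :: "nat \<Rightarrow> 'r :: comm_ring_1 mat monoid" where
  "GL n = units_of (ring_mat TYPE('r) n ())"

text \<open>A representation of \<open>G\<close> on \<open>\<complex>\<^sup>n\<close>; only the values on \<open>carrier G\<close> matter.\<close>

definition complex_rep :: "('g, 'm) monoid_scheme \<Rightarrow> nat \<Rightarrow> ('g \<Rightarrow> complex mat) \<Rightarrow> bool" where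
  "complex_rep G n \<rho> \<longleftrightarrow> \<rho> \<in> hom G (GL n)"

definition irreducible_rep :: "('g, 'm) monoid_scheme \<Rightarrow> nat \<Rightarrow> ('g \<Rightarrow> complex mat) \<Rightarrow> bool" where
  "irreducible_rep G n \<rho> \<longleftrightarrow> complex_rep G n \<rho> \<and> n > 0 \<and>
     (\<forall>W. VectorSpace.subspace class_ring W (module_vec TYPE(complex) n) \<and>
          (\<forall>g\<in>carrier G. \<forall>w\<in>W. \<rho> g *\<^sub>v w \<in> W) \<longrightarrow>
          W = {0\<^sub>v n} \<or> W = carrier_vec n)"

definition has_fixed_vector :: "'g set \<Rightarrow> nat \<Rightarrow> ('g \<Rightarrow> complex mat) \<Rightarrow> bool" where
  "has_fixed_vector U n \<rho> \<longleftrightarrow> (\<exists>v\<in>carrier_vec n. v \<noteq> 0\<^sub>v n \<and> (\<forall>u\<in>U. \<rho> u *\<^sub>v v = v))"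


section \<open>The orbit of a representation of \<open>GL\<^sub>4(\<oo>\<^sub>2)\<close>\<close>

definition K1 :: "'a :: nonarch_local_field intring2 mat set" where
  "K1 = kernel (GL 4) (GL 4 :: 'a resfield mat monoid) (map_mat reduce)"

definition additive_char_conductor_p2 :: "('a :: nonarch_local_field intring \<Rightarrow> complex) \<Rightarrow> bool" where
  "additive_char_conductor_p2 \<psi> \<longleftrightarrow>
     (\<forall>x. \<psi> x \<noteq> 0) \<and> (\<forall>x y. \<psi> (x + y) = \<psi> x * \<psi> y) \<and>
     (\<forall>x\<in>pideal 2. \<psi> x = 1) \<and> (\<exists>x\<in>pideal 1. \<psi> x \<noteq> 1)"

text \<open>The function induced on \<open>\<oo>\<^sub>2\<close> by a character that is trivial on \<open>\<pp>\<^sup>2\<close>.\<close>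

definition char_on_intring2 ::
    "('a :: nonarch_local_field intring \<Rightarrow> complex) \<Rightarrow> 'a intring2 \<Rightarrow> complex" where
  "char_on_intring2 \<psi> y = \<psi> (SOME x. to_intring2 x = y)"

definition mat_trace :: "'r :: comm_ring_1 mat \<Rightarrow> 'r" where
  "mat_trace A = (\<Sum>i<dim_row A. A $$ (i, i))"

text \<open>For \<open>x \<in> K1\<close> the entries of \<open>x - 1\<close> lie in \<open>\<pp>/\<pp>\<^sup>2\<close>, so the value does not
  depend on the chosen lift of \<open>\<beta>\<close>.\<close>

definition psi_char ::
    "('a :: nonarch_local_field intring \<Rightarrow> complex) \<Rightarrow> 'a resfield mat \<Rightarrow> 'a intring2 mat \<Rightarrow> complex" where
  "psi_char \<psi> \<beta> x =
     char_on_intring2 \<psi>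
       (mat_trace ((SOME B. B \<in> carrier_mat 4 4 \<and> map_mat reduce B = \<beta>) * (x - 1\<^sub>m 4)))"

definition rep_orbit ::
    "('a :: nonarch_local_field intring \<Rightarrow> complex) \<Rightarrow> nat \<Rightarrow> ('a intring2 mat \<Rightarrow> complex mat)
      \<Rightarrow> 'a resfield mat set" where
  "rep_orbit \<psi> n \<rho> =
     {\<beta> \<in> carrier_mat 4 4. \<exists>v\<in>carrier_vec n. v \<noteq> 0\<^sub>v n \<and>
        (\<forall>x\<in>K1. \<rho> x *\<^sub>v v = psi_char \<psi> \<beta> x \<cdot>\<^sub>v v)}"

definition strongly_cuspidal ::
    "('a :: nonarch_local_field intring \<Rightarrow> complex) \<Rightarrow> nat \<Rightarrow> ('a intring2 mat \<Rightarrow> complex mat) \<Rightarrow> bool" where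
  "strongly_cuspidal \<psi> n \<rho> \<longleftrightarrow> (\<forall>\<beta>\<in>rep_orbit \<psi> n \<rho>. irreducible (char_poly \<beta>))"


section \<open>Cuspidality\<close>

definition U_geom :: "nat \<Rightarrow> nat \<Rightarrow> 'r :: comm_ring_1 mat set" where
  "U_geom i j = {four_block_mat (1\<^sub>m i) B (0\<^sub>m j i) (1\<^sub>m j) | B. B \<in> carrier_mat i j}"

text \<open>\<open>\<oo>/\<pp>\<^sup>l\<close> (for \<open>l \<le> 2\<close>) is embedded in \<open>\<oo>\<^sub>2\<close> as the submodule \<open>\<pp>\<^bsup>2-l\<^esup>/\<pp>\<^sup>2\<close>, and
  \<open>M\<^sub>\<lambda>\<close> in \<open>\<oo>\<^sub>2\<^sup>4\<close> coordinatewise. Every other embedding of \<open>M\<^sub>\<lambda>\<close> for a partition with four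
  parts contains \<open>\<pp>\<oo>\<^sub>2\<^sup>4\<close> and hence differs from this one by an element of \<open>GL\<^sub>4(\<oo>\<^sub>2)\<close>.\<close>

definition M_sub :: "nat list \<Rightarrow> 'a :: nonarch_local_field intring2 vec set" where
  "M_sub l = {v \<in> carrier_vec 4. \<forall>i<4. v $ i \<in> to_intring2 ` pideal (2 - l ! i)}"

definition P_inf :: "nat list \<Rightarrow> 'a :: nonarch_local_field intring2 mat set" where
  "P_inf l = {g \<in> carrier (GL 4). (\<lambda>v. g *\<^sub>v v) ` M_sub l = M_sub l}"

definition U_inf :: "nat list \<Rightarrow> 'a :: nonarch_local_field intring2 mat set" where
  "U_inf l = {g \<in> P_inf l. \<forall>v\<in>M_sub l. g *\<^sub>v v = v}"

definition cuspidal :: "nat \<Rightarrow> ('a :: nonarch_local_field intring2 mat \<Rightarrow> complex mat) \<Rightarrow> bool" where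
  "cuspidal n \<rho> \<longleftrightarrow>
     (\<forall>\<chi> \<in> hom (units_of (class_ring :: 'a intring2 ring)) (units_of (class_ring :: complex ring)).
        (\<forall>(i, j) \<in> {(1, 3), (2, 2), (3, 1)}.
           \<not> has_fixed_vector (U_geom i j) n (\<lambda>g. \<chi> (det g) \<cdot>\<^sub>m \<rho> g)) \<and>
        (\<forall>l \<in> {[2, 1, 1, 1], [2, 2, 1, 1], [2, 2, 2, 1]}.
           \<not> has_fixed_vector (U_inf l) n (\<lambda>g. \<chi> (det g) \<cdot>\<^sub>m \<rho> g)))"

end

theory Submission
  imports Defs "HOL-Library.Function_Algebras"
begin

text \<open>
  Choose \<open>d\<close> in the residue field such that \<open>x\<^sup>2 - x = d\<close> has no solution. The matrix \<open>C = (0 d; 1 1)\<close>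
  then has no eigenvalue. Let \<open>\<beta> = (C J; 0 C)\<close> in \<open>2 \<times> 2\<close> blocks, where \<open>J\<close> is the matrix unit
  \<open>E\<^sub>1\<^sub>1\<close>. The characteristic polynomial of \<open>\<beta>\<close> is the square of that of \<open>C\<close>, so an irreducible
  representation whose orbit contains \<open>\<beta>\<close> is not strongly cuspidal. The task is to find a cuspidal one.

  The nilpotent matrix \<open>N = (0 1; 0 0)\<close> commutes with \<open>\<beta>\<close>. Let \<open>H\<close> be the preimage in
  \<open>GL\<^sub>4(\<oo>\<^sub>2)\<close> of the group of all \<open>1 + y N\<close> over the residue field. As \<open>\<psi>\<^sub>\<beta>\<close> is trivial on the
  \<open>1 + a N\<close> that lie in \<open>K\<^sub>1\<close>, it extends to a character \<open>\<theta>\<close> of \<open>H\<close> with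
  \<open>\<theta>(1 + a N) = \<psi>(\<varpi> a)\<close>, where \<open>\<varpi>\<close> is a uniformizer (\<open>theta_exponent_mult\<close>). Let \<open>\<rho>\<close> be an irreducible
  subrepresentation of the representation induced from \<open>\<theta>\<close>. It contains \<open>\<theta>\<close>, hence \<open>\<psi>\<^sub>\<beta>\<close>; and if
  a group \<open>U\<close> fixes a nonzero vector of \<open>\<rho>\<close>, then some \<open>g\<close> makes \<open>\<theta>\<close> trivial on
  \<open>g U g\<^sup>-\<^sup>1 \<inter> H\<close> (\<open>ex_irreducible_rep_of_character\<close>).
  Twists by characters of the determinant do not matter, since all elements tested below have determinant \<open>1\<close>.

  It remains to contradict the triviality of \<open>\<theta>\<close> for each \<open>U\<close>. On the elements
  \<open>1 + \<varpi> x E\<^sub>i\<^sub>j\<close> it says that the entry \<open>(j, i)\<close> of \<open>g\<^sup>-\<^sup>1 \<beta> g\<close> vanishes modulo \<open>\<pp>\<close>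
  (\<open>conj_entry_eq_0\<close>). The groups \<open>U\<^sub>3\<^sub>,\<^sub>1\<close> and \<open>U\<^bsub>\<lambda>\<^esub>\<close> for all three \<open>\<lambda>\<close> contain the elements with
  \<open>j\<close> the last index, which gives an eigenvector of the transpose of \<open>\<beta>\<close>; the group \<open>U\<^sub>1\<^sub>,\<^sub>3\<close> gives an
  eigenvector of \<open>\<beta>\<close>. Neither exists, because \<open>C\<close> has no eigenvalue. For \<open>U\<^sub>2\<^sub>,\<^sub>2\<close> one gets that \<open>g\<close> modulo \<open>\<pp>\<close> maps the plane
  spanned by the first two basis vectors to a plane invariant under \<open>\<beta>\<close>. The only such plane is that
  plane itself: another one would be a complement, which forces \<open>J\<close> to be a commutator with \<open>C\<close>,
  although \<open>J\<close> has trace \<open>1\<close> (\<open>orbit_mat_invariant_plane\<close>). Hence \<open>g = k\<^sup>-\<^sup>1 p\<close> with \<open>k \<in> K\<^sub>1\<close> and \<open>p\<close>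
  block upper triangular, so that \<open>g U\<^sub>2\<^sub>,\<^sub>2 g\<^sup>-\<^sup>1\<close> contains \<open>k\<^sup>-\<^sup>1 (1 + a N) k\<close> for all \<open>a\<close>. There \<open>\<theta>\<close>
  has the value \<open>\<psi>(\<varpi> a)\<close>, which is not always \<open>1\<close> (\<open>theta_nontrivial_on_block\<close>).
\<close>


section \<open>Irreducible representations above a character of a subgroup\<close>

text \<open>Take \<open>W\<close> of least dimension: a basis of a smaller \<open>W'\<close> extends to one of \<open>W\<close>, and the
  two have the same size. The ambient space may have infinite dimension, like the space of all
  functions on an infinite type; finiteness comes from \<open>S\<close>.\<close>

lemma (in vector_space) ex_minimal_subspace:
  assumes S: "finite S" and P: "\<And>W. P W \<Longrightarrow> subspace W \<and> W \<subseteq> span S" and V: "P V"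
  obtains W where "P W" "\<And>W'. P W' \<Longrightarrow> W' \<subseteq> W \<Longrightarrow> W' = W"
proof -
  obtain W where W: "P W" and least: "\<And>W'. P W' \<Longrightarrow> dim W \<le> dim W'"
    using ex_has_least_nat[of P V dim] V by blast
  have "W' = W" if W': "P W'" "W' \<subseteq> W" for W'
  proof -
    obtain B' where B': "B' \<subseteq> W'" "independent B'" "W' \<subseteq> span B'" "card B' = dim W'"
      using basis_exists[of W'] by blast
    obtain B where B: "B' \<subseteq> B" "B \<subseteq> W" "independent B" "W \<subseteq> span B"
      using maximal_independent_subset_extend[of B' W] B' W' by blast
    have "finite B"
      using independent_span_bound[OF S B(3)] B(2) P[OF W] by blast
    moreover have "card B \<le> card B'"
      using least[OF W'(1)] B' basis_card_eq_dim[OF B(2,4,3)] by simp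
    ultimately have "B' = B"
      using B(1) by (simp add: card_subset_eq card_mono le_antisym)
    moreover have "span B' \<subseteq> W'"
      using span_minimal[OF B'(1)] P[OF W'(1)] by blast
    ultimately show "W' = W" using B(4) W'(2) by blast
  qed
  thus ?thesis using that W by blast
qed

text \<open>Coordinates with respect to a basis of \<open>W\<close> turn an action by linear maps into one by
  matrices. An invariant subspace of the coordinate space corresponds to an invariant subspace of
  \<open>W\<close>, so minimality of \<open>W\<close> is irreducibility.\<close>

lemma irreducible_rep_of_minimal_action:
  fixes G :: "('g, 'm) monoid_scheme"
    and scale :: "complex \<Rightarrow> 'b :: ab_group_add \<Rightarrow> 'b"
    and act :: "'g \<Rightarrow> 'b \<Rightarrow> 'b"
  assumes vs: "vector_space scale" and G: "group G"
    and W: "Modules.module.subspace scale W" "W \<noteq> {0}"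
    and S: "finite S" "W \<subseteq> Modules.module.span scale S"
    and act_W: "\<And>g w. g \<in> carrier G \<Longrightarrow> w \<in> W \<Longrightarrow> act g w \<in> W"
    and act_add: "\<And>g v w. g \<in> carrier G \<Longrightarrow> v \<in> W \<Longrightarrow> w \<in> W \<Longrightarrow> act g (v + w) = act g v + act g w"
    and act_scale: "\<And>g c w. g \<in> carrier G \<Longrightarrow> w \<in> W \<Longrightarrow> act g (scale c w) = scale c (act g w)"
    and act_one: "\<And>w. w \<in> W \<Longrightarrow> act \<one>\<^bsub>G\<^esub> w = w"
    and act_mult: "\<And>g h w. g \<in> carrier G \<Longrightarrow> h \<in> carrier G \<Longrightarrow> w \<in> W \<Longrightarrow>
        act (g \<otimes>\<^bsub>G\<^esub> h) w = act g (act h w)"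
    and minimal: "\<And>W'. Modules.module.subspace scale W' \<Longrightarrow> W' \<noteq> {0} \<Longrightarrow> W' \<subseteq> W \<Longrightarrow>
        (\<And>g w. g \<in> carrier G \<Longrightarrow> w \<in> W' \<Longrightarrow> act g w \<in> W') \<Longrightarrow> W' = W"
  obtains n \<rho> \<Phi> where "irreducible_rep G n \<rho>"
    "bij_betw \<Phi> (carrier_vec n) W" "\<Phi> (0\<^sub>v n) = 0"
    "\<And>c v. v \<in> carrier_vec n \<Longrightarrow> \<Phi> (c \<cdot>\<^sub>v v) = scale c (\<Phi> v)"
    "\<And>g v. g \<in> carrier G \<Longrightarrow> v \<in> carrier_vec n \<Longrightarrow> \<Phi> (\<rho> g *\<^sub>v v) = act g (\<Phi> v)"
proof -
  interpret vector_space scale by (rule vs)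
  obtain B where B: "B \<subseteq> W" "independent B" "W \<subseteq> span B"
    by (rule basis_exists[of W])
  have finB: "finite B"
    using independent_span_bound[OF S(1) B(2)] B(1) S(2) by blast
  have spanB: "span B = W"
    using span_minimal[OF B(1) W(1)] B(3) by blast
  define n where "n = card B"
  obtain b where b: "bij_betw b {..<n} B"
    using ex_bij_betw_nat_finite[OF finB] by (auto simp: n_def lessThan_atLeast0)
  have bW: "b i \<in> W" if "i < n" for i
    using bij_betwE[OF b] B(1) that by auto
  have n0: "n > 0"
    using spanB W(2) finB by (auto simp: n_def card_gt_0_iff)
  define \<Phi> where "\<Phi> v = (\<Sum>i<n. scale (v $ i) (b i))" for v
  define coord where "coord w = vec n (\<lambda>i. representation B w (b i))" for w
  have coord_carrier [simp]: "coord w \<in> carrier_vec n" for w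
    by (simp add: coord_def)
  have \<Phi>_coord: "\<Phi> (coord w) = w" if w: "w \<in> W" for w
  proof -
    have "\<Phi> (coord w) = (\<Sum>i<n. scale (representation B w (b i)) (b i))"
      unfolding \<Phi>_def coord_def by (rule sum.cong) auto
    also have "\<dots> = (\<Sum>x\<in>B. scale (representation B w x) x)"
      by (rule sum.reindex_bij_betw[OF b])
    also have "\<dots> = w"
      using sum_representation_eq[OF B(2) _ finB order_refl] w spanB by blast
    finally show ?thesis .
  qed
  have \<Phi>_W: "\<Phi> v \<in> W" for v
    unfolding \<Phi>_def by (intro subspace_sum[OF W(1)] subspace_scale[OF W(1)] bW) auto
  have coord_\<Phi>: "coord (\<Phi> v) = v" if v: "v \<in> carrier_vec n" for v
  proof (rule eq_vecI)
    fix i assume "i < dim_vec v"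
    hence i: "i < n" using v by auto
    define u where "u = coord (\<Phi> v) - v"
    have u: "u \<in> carrier_vec n" using v by (simp add: u_def)
    have "(\<Sum>i<n. scale (u $ i) (b i)) = \<Phi> (coord (\<Phi> v)) - \<Phi> v"
      using v unfolding \<Phi>_def[of v] \<Phi>_def[of "coord _"] sum_subtractf [symmetric] u_def
      by (intro sum.cong) (auto simp: scale_left_diff_distrib)
    also have "\<dots> = 0" by (simp add: \<Phi>_coord \<Phi>_W)
    finally have "(\<Sum>i<n. scale (u $ the_inv_into {..<n} b (b i)) (b i)) = 0"
      by (subst (asm) sum.cong[OF refl, of _ _ "\<lambda>i. scale (u $ the_inv_into {..<n} b (b i)) (b i)"])
        (auto simp: the_inv_into_f_f[OF bij_betw_imp_inj_on[OF b]])
    hence "(\<Sum>x\<in>B. scale (u $ the_inv_into {..<n} b x) x) = 0"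
      by (subst sum.reindex_bij_betw[OF b, symmetric])
    hence "u $ the_inv_into {..<n} b (b i) = 0"
      using independentD[OF B(2) finB order_refl, of "\<lambda>x. u $ the_inv_into {..<n} b x" "b i"]
        bij_betwE[OF b] i by blast
    hence "u $ i = 0"
      using i by (simp add: the_inv_into_f_f[OF bij_betw_imp_inj_on[OF b]])
    thus "coord (\<Phi> v) $ i = v $ i"
      using i v by (simp add: u_def)
  qed (use v in auto)
  have bij: "bij_betw \<Phi> (carrier_vec n) W"
    by (rule bij_betw_byWitness[of _ coord]) (auto simp: coord_\<Phi> \<Phi>_coord \<Phi>_W)
  have \<Phi>_0: "\<Phi> (0\<^sub>v n) = 0"
    by (simp add: \<Phi>_def)
  have \<Phi>_add: "\<Phi> (v + w) = \<Phi> v + \<Phi> w"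
    if "v \<in> carrier_vec n" "w \<in> carrier_vec n" for v w
    using that unfolding \<Phi>_def sum.distrib [symmetric]
    by (intro sum.cong) (auto simp: scale_left_distrib)
  have \<Phi>_smult: "\<Phi> (c \<cdot>\<^sub>v v) = scale c (\<Phi> v)"
    if "v \<in> carrier_vec n" for c v
    using that unfolding \<Phi>_def scale_sum_right by (intro sum.cong) auto
  define \<rho> where "\<rho> g = mat n n (\<lambda>(i, j). coord (act g (b j)) $ i)" for g
  have \<rho>_carrier [simp]: "\<rho> g \<in> carrier_mat n n" for g
    by (simp add: \<rho>_def)
  have act_0: "act g 0 = 0" if "g \<in> carrier G" for g
    using act_scale[OF that subspace_0[OF W(1)], of 0] by simp
  have act_sum: "act g (\<Sum>i\<in>I. f i) = (\<Sum>i\<in>I. act g (f i))"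
    if g: "g \<in> carrier G" and "finite I" "\<And>i. i \<in> I \<Longrightarrow> f i \<in> W" for g I and f :: "nat \<Rightarrow> 'b"
    using that(2,3)
    by (induction I rule: finite_induct) (simp_all add: g act_0 act_add subspace_sum[OF W(1)])
  have equi: "\<Phi> (\<rho> g *\<^sub>v v) = act g (\<Phi> v)" if g: "g \<in> carrier G" and v: "v \<in> carrier_vec n" for g v
  proof -
    have "\<Phi> (\<rho> g *\<^sub>v v) = (\<Sum>i<n. scale (\<Sum>j<n. coord (act g (b j)) $ i * v $ j) (b i))"
      unfolding \<Phi>_def using v
      by (intro sum.cong) (auto simp: \<rho>_def scalar_prod_def lessThan_atLeast0)
    also have "\<dots> = (\<Sum>j<n. scale (v $ j) (\<Phi> (coord (act g (b j)))))"
      unfolding \<Phi>_def scale_sum_left scale_sum_right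
      by (subst sum.swap) (simp add: mult.commute)
    also have "\<dots> = (\<Sum>j<n. act g (scale (v $ j) (b j)))"
      by (intro sum.cong) (auto simp: \<Phi>_coord act_W[OF g] bW act_scale[OF g])
    also have "\<dots> = act g (\<Phi> v)"
      unfolding \<Phi>_def
      by (rule act_sum[OF g, symmetric]) (auto intro!: subspace_scale[OF W(1)] bW)
    finally show ?thesis .
  qed
  have mat_eqI: "A = A'" if A: "A \<in> carrier_mat n n" "A' \<in> carrier_mat n n"
    and eq: "\<And>v. v \<in> carrier_vec n \<Longrightarrow> \<Phi> (A *\<^sub>v v) = \<Phi> (A' *\<^sub>v v)" for A A'
  proof -
    have *: "A *\<^sub>v v = A' *\<^sub>v v" if v: "v \<in> carrier_vec n" for v
      by (metis eq[OF v] coord_\<Phi> mult_mat_vec_carrier A v)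
    show ?thesis
    proof (rule eq_matI)
      fix i j assume "i < dim_row A'" "j < dim_col A'"
      hence ij: "i < n" "j < n" using A by auto
      have "(A *\<^sub>v unit_vec n j) $ i = (A' *\<^sub>v unit_vec n j) $ i"
        using *[of "unit_vec n j"] by simp
      thus "A $$ (i, j) = A' $$ (i, j)"
        using A ij by simp
    qed (use A in auto)
  qed
  have \<rho>_mult: "\<rho> (g \<otimes>\<^bsub>G\<^esub> h) = \<rho> g * \<rho> h" if "g \<in> carrier G" "h \<in> carrier G" for g h
  proof (rule mat_eqI)
    fix v :: "complex vec" assume v: "v \<in> carrier_vec n"
    have hv: "\<rho> h *\<^sub>v v \<in> carrier_vec n"
      by (rule mult_mat_vec_carrier[OF \<rho>_carrier v])
    have "\<Phi> ((\<rho> g * \<rho> h) *\<^sub>v v) = \<Phi> (\<rho> g *\<^sub>v (\<rho> h *\<^sub>v v))"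
      by (subst assoc_mult_mat_vec[OF \<rho>_carrier \<rho>_carrier v]) simp
    also have "\<dots> = \<Phi> (\<rho> (g \<otimes>\<^bsub>G\<^esub> h) *\<^sub>v v)"
      using that v hv monoid.m_closed[OF group.is_monoid[OF G] that]
      by (simp add: equi act_mult \<Phi>_W)
    finally show "\<Phi> (\<rho> (g \<otimes>\<^bsub>G\<^esub> h) *\<^sub>v v) = \<Phi> ((\<rho> g * \<rho> h) *\<^sub>v v)" by simp
  qed (simp_all add: mult_carrier_mat[OF \<rho>_carrier \<rho>_carrier])
  have \<rho>_one: "\<rho> \<one>\<^bsub>G\<^esub> = 1\<^sub>m n"
    by (rule mat_eqI) (auto simp: equi act_one \<Phi>_W monoid.one_closed[OF group.is_monoid[OF G]])
  have "complex_rep G n \<rho>"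
    unfolding complex_rep_def
  proof (rule homI)
    fix g assume g: "g \<in> carrier G"
    have "\<rho> (inv\<^bsub>G\<^esub> g) * \<rho> g = 1\<^sub>m n" "\<rho> g * \<rho> (inv\<^bsub>G\<^esub> g) = 1\<^sub>m n"
      using g by (simp_all add: \<rho>_mult [symmetric] \<rho>_one group.inv_closed[OF G]
          group.l_inv[OF G] group.r_inv[OF G])
    thus "\<rho> g \<in> carrier (GL n)"
      by (auto simp: GL_def units_of_def Units_def ring_mat_simps intro!: bexI[of _ "\<rho> (inv\<^bsub>G\<^esub> g)"])
  qed (simp add: \<rho>_mult GL_def units_of_def ring_mat_simps)
  moreover have "U = {0\<^sub>v n} \<or> U = carrier_vec n"
    if U: "VectorSpace.subspace class_ring U (module_vec TYPE(complex) n)"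
      and inv: "\<forall>g\<in>carrier G. \<forall>w\<in>U. \<rho> g *\<^sub>v w \<in> U" for U
  proof (cases "U = {0\<^sub>v n}")
    case False
    interpret sm: submodule class_ring U "module_vec TYPE(complex) n"
      using U by (simp add: VectorSpace.subspace_def)
    have Uc: "U \<subseteq> carrier_vec n"
      using sm.subset by (simp add: module_vec_simps)
    have U0: "0\<^sub>v n \<in> U"
      using sm.zero_closed by (simp add: module_vec_simps)
    have Uadd: "v + w \<in> U" if "v \<in> U" "w \<in> U" for v w
      using sm.m_closed[OF that] by (simp add: module_vec_simps)
    have Usmult: "c \<cdot>\<^sub>v v \<in> U" if "v \<in> U" for c v
      using sm.smult_closed[of c v] that by (simp add: module_vec_simps class_ring_simps)
    have "\<Phi> ` U = W"
    proof (rule minimal)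
      show "subspace (\<Phi> ` U)"
      proof (rule subspaceI)
        show "0 \<in> \<Phi> ` U" using U0 \<Phi>_0 by force
        fix x y assume "x \<in> \<Phi> ` U" "y \<in> \<Phi> ` U"
        then obtain v w where "x = \<Phi> v" "y = \<Phi> w" "v \<in> U" "w \<in> U" by blast
        thus "x + y \<in> \<Phi> ` U"
          using \<Phi>_add[of v w] by (intro image_eqI[OF _ Uadd[of v w]]) (simp_all add: subsetD[OF Uc])
      next
        fix c x assume "x \<in> \<Phi> ` U"
        then obtain v where "x = \<Phi> v" "v \<in> U" by blast
        thus "scale c x \<in> \<Phi> ` U"
          using \<Phi>_smult[of v c] by (intro image_eqI[OF _ Usmult[of v c]]) (simp_all add: subsetD[OF Uc])
      qed
      obtain v where v: "v \<in> U" "v \<noteq> 0\<^sub>v n"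
        using False U0 by blast
      hence "\<Phi> v \<noteq> 0"
        using \<Phi>_0 coord_\<Phi>[of v] coord_\<Phi>[of "0\<^sub>v n"] Uc by auto
      thus "\<Phi> ` U \<noteq> {0}" using v by blast
      show "act g w \<in> \<Phi> ` U" if g: "g \<in> carrier G" and w: "w \<in> \<Phi> ` U" for g w
      proof -
        obtain u where u: "w = \<Phi> u" "u \<in> U" using w by blast
        show ?thesis
          using u equi[OF g, of u] inv g Uc by (intro image_eqI[of _ _ "\<rho> g *\<^sub>v u"]) auto
      qed
    qed (use \<Phi>_W in auto)
    hence "U = carrier_vec n"
      using bij Uc by (metis bij_betw_def inj_on_image_eq_iff order_refl)
    thus ?thesis by blast
  qed simp
  ultimately have "irreducible_rep G n \<rho>"
    unfolding irreducible_rep_def using n0 by blast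
  thus ?thesis
    using that bij \<Phi>_0 \<Phi>_smult equi by blast
qed

text \<open>The representation is a minimal invariant subspace \<open>W\<close> of the induced representation, that
  is, of the functions \<open>f\<close> with \<open>f (h x) = \<theta> h f x\<close> on which the group acts by right translation.
  If \<open>u\<close> fixes \<open>f\<close> and \<open>f g \<noteq> 0\<close>, then \<open>f g = f (g u) = \<theta> (g u g\<^sup>-\<^sup>1) f g\<close>; this is the half of Mackey
  theory needed to exclude fixed vectors, and it passes to subrepresentations. The
  eigenvector for \<open>\<theta>\<close> is the projection of an \<open>f \<in> W\<close> with \<open>f 1 \<noteq> 0\<close> to the isotypic part, which
  multiplies the value at \<open>1\<close> by the order of \<open>H\<close>.\<close>

lemma ex_irreducible_rep_of_character:
  fixes G :: "('g, 'm) monoid_scheme" (structure) and \<theta> :: "'g \<Rightarrow> complex"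
  assumes G: "group G" and fin: "finite (carrier G)" and H: "subgroup H G"
    and \<theta>_mult: "\<And>x y. x \<in> H \<Longrightarrow> y \<in> H \<Longrightarrow> \<theta> (x \<otimes>\<^bsub>G\<^esub> y) = \<theta> x * \<theta> y"
    and \<theta>_nz: "\<And>x. x \<in> H \<Longrightarrow> \<theta> x \<noteq> 0"
  obtains n \<rho> where "irreducible_rep G n \<rho>"
    "\<exists>v\<in>carrier_vec n. v \<noteq> 0\<^sub>v n \<and> (\<forall>h\<in>H. \<rho> h *\<^sub>v v = \<theta> h \<cdot>\<^sub>v v)"
    "\<And>v. v \<in> carrier_vec n \<Longrightarrow> v \<noteq> 0\<^sub>v n \<Longrightarrow> \<exists>g\<in>carrier G. \<forall>u\<in>carrier G.
        \<rho> u *\<^sub>v v = v \<longrightarrow> g \<otimes>\<^bsub>G\<^esub> u \<otimes>\<^bsub>G\<^esub> inv\<^bsub>G\<^esub> g \<in> H \<longrightarrow> \<theta> (g \<otimes>\<^bsub>G\<^esub> u \<otimes>\<^bsub>G\<^esub> inv\<^bsub>G\<^esub> g) = 1"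
proof -
  interpret group G by (rule G)
  interpret H: subgroup H G by (rule H)
  define scale where "scale c f = (\<lambda>x. c * f x)" for c :: complex and f :: "'g \<Rightarrow> complex"
  have scale_apply [simp]: "scale c f x = c * f x" for c f x
    by (simp add: scale_def)
  have vs: "vector_space scale"
    by unfold_locales (auto simp: fun_eq_iff algebra_simps)
  interpret F: vector_space scale by (rule vs)
  have sum_fun: "(\<Sum>i\<in>I. f i) x = (\<Sum>i\<in>I. f i x)"
    for I :: "'g set" and f :: "'g \<Rightarrow> 'g \<Rightarrow> complex" and x
    by (induction I rule: infinite_finite_induct) auto
  define Ind where "Ind = {f :: 'g \<Rightarrow> complex. (\<forall>x. x \<notin> carrier G \<longrightarrow> f x = 0) \<and>
    (\<forall>h\<in>H. \<forall>x\<in>carrier G. f (h \<otimes> x) = \<theta> h * f x)}"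
  have IndD: "f x = 0" if "f \<in> Ind" "x \<notin> carrier G" for f x
    using that by (auto simp: Ind_def)
  have Ind_equi: "f (h \<otimes> x) = \<theta> h * f x" if "f \<in> Ind" "h \<in> H" "x \<in> carrier G" for f h x
    using that by (auto simp: Ind_def)
  have Ind_nz: "\<exists>g\<in>carrier G. f g \<noteq> 0" if "f \<in> Ind" "f \<noteq> 0" for f
    using that IndD by (auto simp: fun_eq_iff)
  define act where "act g f = (\<lambda>x. if x \<in> carrier G then f (x \<otimes> g) else (0 :: complex))" for g f
  have act_add: "act g (v + w) = act g v + act g w" for g v w
    by (auto simp: act_def)
  have act_scale: "act g (scale c w) = scale c (act g w)" for g c w
    by (auto simp: act_def)
  have act_one: "act \<one> w = w" if "w \<in> Ind" for w
    using IndD[OF that] by (auto simp: act_def)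
  have act_mult: "act (g \<otimes> h) w = act g (act h w)" if "g \<in> carrier G" "h \<in> carrier G" for g h w
    using that by (auto simp: act_def m_assoc)
  have act_Ind: "act g f \<in> Ind" if "g \<in> carrier G" "f \<in> Ind" for g f
    using that by (auto simp: Ind_def act_def m_assoc)
  define inv_sub where "inv_sub W \<longleftrightarrow> F.subspace W \<and> W \<noteq> {0} \<and> W \<subseteq> Ind \<and>
    (\<forall>g\<in>carrier G. \<forall>w\<in>W. act g w \<in> W)" for W
  define \<delta> where "\<delta> g = (\<lambda>x. if x = g then (1 :: complex) else 0)" for g :: 'g
  have Ind_span: "Ind \<subseteq> F.span (\<delta> ` carrier G)"
  proof
    fix f assume f: "f \<in> Ind"
    have "f = (\<Sum>g\<in>carrier G. scale (f g) (\<delta> g))"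
    proof
      fix x
      have "(\<Sum>g\<in>carrier G. scale (f g) (\<delta> g)) x = (\<Sum>g\<in>carrier G. if x = g then f g else 0)"
        unfolding sum_fun by (intro sum.cong) (auto simp: \<delta>_def)
      also have "\<dots> = f x"
        using IndD[OF f, of x] by (simp add: fin)
      finally show "f x = (\<Sum>g\<in>carrier G. scale (f g) (\<delta> g)) x" by simp
    qed
    also have "\<dots> \<in> F.span (\<delta> ` carrier G)"
      by (intro F.span_sum F.span_scale F.span_base imageI)
    finally show "f \<in> F.span (\<delta> ` carrier G)" .
  qed
  have "inv_sub Ind"
    unfolding inv_sub_def
  proof (intro conjI ballI)
    show "F.subspace Ind"
      by (rule F.subspaceI) (auto simp: Ind_def algebra_simps)
    define f0 where "f0 = (\<lambda>x. if x \<in> H then \<theta> x else 0)"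
    have "h \<otimes> x \<in> H \<longleftrightarrow> x \<in> H" if "h \<in> H" "x \<in> carrier G" for h x
    proof
      assume "h \<otimes> x \<in> H"
      hence "inv h \<otimes> (h \<otimes> x) \<in> H" using that by auto
      thus "x \<in> H" using that by (simp add: m_assoc [symmetric])
    qed (use that in auto)
    hence "f0 \<in> Ind"
      by (auto simp: Ind_def f0_def \<theta>_mult)
    moreover have "f0 \<one> \<noteq> 0"
      by (simp add: f0_def \<theta>_nz)
    ultimately show "Ind \<noteq> {0}" by auto
  qed (auto simp: act_Ind)
  from _ _ this obtain W where W: "inv_sub W" and minimal: "\<And>W'. inv_sub W' \<Longrightarrow> W' \<subseteq> W \<Longrightarrow> W' = W"
    by (rule F.ex_minimal_subspace[of "\<delta> ` carrier G"])
      (use fin Ind_span in \<open>auto simp: inv_sub_def\<close>)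
  have WI: "w \<in> Ind" if "w \<in> W" for w
    using W that by (auto simp: inv_sub_def)
  have Wsub: "F.subspace W" and W0: "W \<noteq> {0}"
    and Wact: "\<And>g w. g \<in> carrier G \<Longrightarrow> w \<in> W \<Longrightarrow> act g w \<in> W"
    using W by (auto simp: inv_sub_def)
  obtain n \<rho> \<Phi> where irr: "irreducible_rep G n \<rho>" and bij: "bij_betw \<Phi> (carrier_vec n) W"
    and \<Phi>_0: "\<Phi> (0\<^sub>v n) = 0"
    and \<Phi>_smult: "\<And>c v. v \<in> carrier_vec n \<Longrightarrow> \<Phi> (c \<cdot>\<^sub>v v) = scale c (\<Phi> v)"
    and equi: "\<And>g v. g \<in> carrier G \<Longrightarrow> v \<in> carrier_vec n \<Longrightarrow> \<Phi> (\<rho> g *\<^sub>v v) = act g (\<Phi> v)"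
  proof (rule irreducible_rep_of_minimal_action[OF vs G Wsub W0, of "\<delta> ` carrier G" act])
    show "finite (\<delta> ` carrier G)" using fin by simp
    show "W \<subseteq> F.span (\<delta> ` carrier G)" using WI Ind_span by auto
    show "W' = W" if "F.subspace W'" "W' \<noteq> {0}" "W' \<subseteq> W"
      "\<And>g w. g \<in> carrier G \<Longrightarrow> w \<in> W' \<Longrightarrow> act g w \<in> W'" for W'
      using that WI by (intro minimal) (auto simp: inv_sub_def)
  qed (auto simp: act_add act_scale act_mult intro: Wact act_one WI)
  have \<rho>_carrier: "\<rho> g \<in> carrier_mat n n" if "g \<in> carrier G" for g
    using irr hom_carrier[of \<rho> G "GL n"] that
    by (auto simp: irreducible_rep_def complex_rep_def GL_def units_of_def Units_def ring_mat_simps)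
  have \<Phi>_inj: "v = w" if "\<Phi> v = \<Phi> w" "v \<in> carrier_vec n" "w \<in> carrier_vec n" for v w
    using bij that by (meson bij_betw_def inj_onD)
  have fixed: "\<exists>g\<in>carrier G. \<forall>u\<in>carrier G.
        \<rho> u *\<^sub>v v = v \<longrightarrow> g \<otimes> u \<otimes> inv g \<in> H \<longrightarrow> \<theta> (g \<otimes> u \<otimes> inv g) = 1"
    if v: "v \<in> carrier_vec n" "v \<noteq> 0\<^sub>v n" for v
  proof -
    have f: "\<Phi> v \<in> Ind" "\<Phi> v \<noteq> 0"
      using v bij WI \<Phi>_inj[of v "0\<^sub>v n"] \<Phi>_0 by (auto simp: bij_betw_def)
    then obtain g where g: "g \<in> carrier G" "\<Phi> v g \<noteq> 0"
      using Ind_nz by blast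
    have "\<theta> (g \<otimes> u \<otimes> inv g) = 1"
      if u: "u \<in> carrier G" "\<rho> u *\<^sub>v v = v" "g \<otimes> u \<otimes> inv g \<in> H" for u
    proof -
      have "\<Phi> v g = act u (\<Phi> v) g"
        using equi[OF u(1) v(1)] u(2) by simp
      also have "\<dots> = \<Phi> v (g \<otimes> u \<otimes> inv g \<otimes> g)"
        using g u by (simp add: act_def m_assoc)
      also have "\<dots> = \<theta> (g \<otimes> u \<otimes> inv g) * \<Phi> v g"
        by (rule Ind_equi[OF f(1) u(3) g(1)])
      finally show ?thesis using g(2) by simp
    qed
    thus ?thesis using g(1) by blast
  qed
  have "\<exists>f\<in>W. f \<noteq> 0 \<and> (\<forall>k\<in>H. act k f = scale (\<theta> k) f)"
  proof -
    obtain f1 where f1: "f1 \<in> W" "f1 \<noteq> 0"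
      using W0 F.subspace_0[OF Wsub] by blast
    then obtain x where x: "x \<in> carrier G" "f1 x \<noteq> 0"
      using Ind_nz WI by blast
    define f2 where "f2 = act x f1"
    have f2: "f2 \<in> W" "f2 \<one> \<noteq> 0"
      using x f1 Wact by (auto simp: f2_def act_def)
    have finH: "finite H" using fin H.subset finite_subset by blast
    \<comment> \<open>up to a scalar, the projection to the \<open>\<theta>\<close>-isotypic part\<close>
    define f where "f = (\<Sum>h\<in>H. scale (inverse (\<theta> h)) (act h f2))"
    have f_W: "f \<in> W"
      unfolding f_def by (intro F.subspace_sum[OF Wsub] F.subspace_scale[OF Wsub] Wact f2(1)) auto
    have f_apply: "f x = (\<Sum>h\<in>H. inverse (\<theta> h) * f2 (x \<otimes> h))" if "x \<in> carrier G" for x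
      unfolding f_def sum_fun using that by (simp add: act_def)
    have f2_H: "inverse (\<theta> h) * f2 (\<one> \<otimes> h) = f2 \<one>" if "h \<in> H" for h
      using Ind_equi[OF WI[OF f2(1)] that one_closed] that \<theta>_nz[OF that] by simp
    have "f \<one> = (\<Sum>h\<in>H. f2 \<one>)"
      unfolding f_apply[OF one_closed] by (intro sum.cong refl f2_H)
    also have "\<dots> \<noteq> 0"
      using f2(2) finH card_0_eq[OF finH] H.one_closed
      by (metis empty_iff mult_eq_0_iff of_nat_eq_0_iff sum_constant)
    finally have "f \<one> \<noteq> 0" .
    moreover have "act k f = scale (\<theta> k) f" if k: "k \<in> H" for k
    proof
      fix y
      show "act k f y = scale (\<theta> k) f y"
      proof (cases "y \<in> carrier G")
        case True
        have bijk: "bij_betw (\<lambda>h. k \<otimes> h) H H"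
          by (rule bij_betw_byWitness[of _ "\<lambda>h. inv k \<otimes> h"]) (use k in \<open>auto simp: m_assoc [symmetric]\<close>)
        have "act k f y = (\<Sum>h\<in>H. inverse (\<theta> h) * f2 (y \<otimes> k \<otimes> h))"
          using True k by (simp add: act_def f_apply)
        also have "\<dots> = (\<Sum>h\<in>H. \<theta> k * (inverse (\<theta> (k \<otimes> h)) * f2 (y \<otimes> (k \<otimes> h))))"
          using True k by (intro sum.cong) (auto simp: \<theta>_mult \<theta>_nz m_assoc)
        also have "\<dots> = \<theta> k * (\<Sum>h\<in>H. inverse (\<theta> h) * f2 (y \<otimes> h))"
          unfolding sum_distrib_left [symmetric]
          using sum.reindex_bij_betw[OF bijk, of "\<lambda>h. inverse (\<theta> h) * f2 (y \<otimes> h)"] by simp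
        finally show ?thesis using True by (simp add: f_apply)
      next
        case False
        thus ?thesis using IndD[OF WI[OF f_W]] by (simp add: act_def)
      qed
    qed
    ultimately show ?thesis using f_W by (metis zero_fun_apply)
  qed
  then obtain f where f: "f \<in> W" "f \<noteq> 0" "\<And>k. k \<in> H \<Longrightarrow> act k f = scale (\<theta> k) f"
    by blast
  obtain v where v: "v \<in> carrier_vec n" "\<Phi> v = f"
    using bij f(1) by (auto simp: bij_betw_def)
  have "\<rho> h *\<^sub>v v = \<theta> h \<cdot>\<^sub>v v" if "h \<in> H" for h
    using that v f(3) equi[of h v] \<Phi>_smult[of v "\<theta> h"]
    by (intro \<Phi>_inj mult_mat_vec_carrier[OF \<rho>_carrier]) auto
  moreover have "v \<noteq> 0\<^sub>v n"
    using \<Phi>_0 v f(2) by auto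
  ultimately show ?thesis
    using that[OF irr _ fixed] v(1) by blast
qed

section \<open>The ring of integers modulo the square of its maximal ideal\<close>

lemma ex_uniformizer: "\<exists>w :: 'a :: nonarch_local_field intring. pideal 1 = range (\<lambda>x. w * x)"
proof -
  obtain r :: 'a where r: "r \<noteq> 0" "val r = 1"
    using val_normalised by blast
  have r0: "val_ge 0 r" and r1: "val_ge 1 r"
    using r by (auto simp: val_ge_def)
  define w where "w = Abs_intring r"
  have w: "Rep_intring w = r"
    using r0 by (simp add: w_def Abs_intring_inverse)
  have "x \<in> range (\<lambda>x. w * x)" if x: "x \<in> pideal 1" for x
  proof -
    have "val_ge (1 + (-1)) (Rep_intring x * inverse r)"
      using x r by (intro val_ge_mult) (auto simp: pideal_def val_ge_def val_inverse)
    hence q: "val_ge 0 (Rep_intring x * inverse r)" by simp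
    have "x = w * Abs_intring (Rep_intring x * inverse r)"
      using r q by (simp add: Rep_intring_inject [symmetric] times_intring.rep_eq
          Abs_intring_inverse w)
    thus ?thesis by blast
  qed
  moreover have "w * x \<in> pideal 1" for x
    using pideal_mult[of w 1 x] r1 by (simp add: pideal_def w mult.commute)
  ultimately show ?thesis by blast
qed

definition uniformizer :: "'a :: nonarch_local_field intring2" where
  "uniformizer = to_intring2 (SOME w. pideal 1 = range (\<lambda>x. w * x))"

lemma to_intring2_mult: "to_intring2 (x * y) = to_intring2 x * to_intring2 y"
  by (simp add: to_intring2_def times_intring2.abs_eq)

lemma to_intring2_add: "to_intring2 (x + y) = to_intring2 x + to_intring2 y"
  by (simp add: to_intring2_def plus_intring2.abs_eq)

lemma to_intring2_surj: obtains y where "x = to_intring2 y"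
  unfolding to_intring2_def by (metis Quotient3_abs_rep Quotient3_intring2)

lemma to_intring2_eq_iff: "to_intring2 x = to_intring2 y \<longleftrightarrow> x - y \<in> pideal 2"
  unfolding to_intring2_def by (rule intring2.abs_eq_iff)

lemma to_intring2_eq_0_iff: "to_intring2 x = 0 \<longleftrightarrow> x \<in> pideal 2"
  using to_intring2_eq_iff[of x 0] by (simp add: to_intring2_def zero_intring2_def)

lemma reduce_to_intring2: "reduce (to_intring2 x) = abs_resfield x"
  by (simp add: to_intring2_def reduce.abs_eq)

lemma reduce_to_intring2_eq_0_iff: "reduce (to_intring2 x) = 0 \<longleftrightarrow> x \<in> pideal 1"
  unfolding reduce_to_intring2 zero_resfield_def resfield.abs_eq_iff by simp

lemma pideal_1_uniformizer:
  "pideal 1 = range (\<lambda>x. (SOME w. pideal 1 = range (\<lambda>x. w * x)) * x :: 'a :: nonarch_local_field intring)"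
  by (rule someI_ex[OF ex_uniformizer])

lemma reduce_eq_0_iff: "reduce x = 0 \<longleftrightarrow> (\<exists>y. x = uniformizer * y)"
proof
  assume x: "reduce x = 0"
  obtain z where z: "x = to_intring2 z" by (rule to_intring2_surj)
  hence "z \<in> pideal 1" using x by (simp add: reduce_to_intring2_eq_0_iff)
  then obtain y where "z = (SOME w. pideal 1 = range (\<lambda>x. w * x)) * y"
    using pideal_1_uniformizer by blast
  thus "\<exists>y. x = uniformizer * y"
    by (auto simp: z uniformizer_def to_intring2_mult)
next
  assume "\<exists>y. x = uniformizer * y"
  then obtain y where y: "x = uniformizer * y" by blast
  obtain z where z: "y = to_intring2 z" by (rule to_intring2_surj)
  show "reduce x = 0"
    unfolding y z uniformizer_def to_intring2_mult [symmetric] reduce_to_intring2_eq_0_iff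
    using pideal_1_uniformizer by blast
qed

lemma uniformizer_uniformizer [simp]: "uniformizer * uniformizer = (0 :: 'a :: nonarch_local_field intring2)"
proof -
  let ?w = "SOME w :: 'a intring. pideal 1 = range (\<lambda>x. w * x)"
  have "?w * 1 \<in> pideal 1" using pideal_1_uniformizer by blast
  hence "?w * ?w \<in> pideal 2" unfolding pideal_2 by auto
  thus ?thesis
    by (simp add: uniformizer_def to_intring2_mult [symmetric] to_intring2_eq_0_iff)
qed

lemma uniformizer_uniformizer_mult [simp]: "uniformizer * (uniformizer * x) = (0 :: 'a :: nonarch_local_field intring2)"
  by (simp add: mult.assoc [symmetric])

lemma reduce_0 [simp]: "reduce 0 = 0" and reduce_1 [simp]: "reduce 1 = 1"
  by (transfer, simp)+

lemma reduce_add [simp]: "reduce (x + y) = reduce x + reduce y"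
  by transfer simp

lemma reduce_diff [simp]: "reduce (x - y) = reduce x - reduce y"
  by transfer simp

lemma reduce_mult [simp]: "reduce (x * y) = reduce x * reduce y"
  by transfer simp

lemma reduce_uniformizer [simp]: "reduce uniformizer = 0"
  by (auto simp: reduce_eq_0_iff intro: exI[of _ 1])

interpretation reduce: comm_ring_hom reduce
  by unfold_locales auto

lemma reduce_surj: obtains y where "x = reduce y"
  by (metis Quotient3_abs_rep Quotient3_resfield reduce_to_intring2)

lemma reduce_nonzero_unit:
  assumes "reduce x \<noteq> 0" obtains y where "x * y = 1"
proof -
  obtain z where z: "x = to_intring2 z" by (rule to_intring2_surj)
  hence "z \<notin> pideal 1" using assms by (simp add: reduce_to_intring2_eq_0_iff)
  then obtain y where "z * y = 1" by (rule unit_if_notin_pideal)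
  hence "x * to_intring2 y = 1"
    by (simp add: z to_intring2_mult [symmetric]) (simp add: to_intring2_def one_intring2_def)
  thus ?thesis by (rule that)
qed

lemma finite_UNIV_resfield: "finite (UNIV :: 'a :: nonarch_local_field resfield set)"
proof -
  let ?R = "{(x :: 'a, y). val_ge 0 x \<and> val_ge 0 y \<and> val_ge 1 (x - y)}"
  have "UNIV \<subseteq> (\<lambda>X. abs_resfield (Abs_intring (SOME x. x \<in> X))) ` ({x :: 'a. val_ge 0 x} // ?R)"
  proof
    fix c :: "'a resfield"
    obtain z where z: "c = abs_resfield z" by (metis Quotient3_abs_rep Quotient3_resfield)
    define X where "X = ?R `` {Rep_intring z}"
    have "Rep_intring z \<in> X"
      using Rep_intring[of z] by (simp add: X_def)
    hence "(SOME x. x \<in> X) \<in> X" by (rule someI)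
    hence s: "val_ge 0 (SOME x. x \<in> X)" "val_ge 1 (Rep_intring z - (SOME x. x \<in> X))"
      unfolding X_def by blast+
    hence "z - Abs_intring (SOME x. x \<in> X) \<in> pideal 1"
      by (simp add: pideal_def minus_intring.rep_eq Abs_intring_inverse)
    hence "c = abs_resfield (Abs_intring (SOME x. x \<in> X))"
      unfolding z resfield.abs_eq_iff .
    moreover have "X \<in> {x :: 'a. val_ge 0 x} // ?R"
      unfolding X_def using Rep_intring[of z] by (intro quotientI) simp
    ultimately show "c \<in> (\<lambda>X. abs_resfield (Abs_intring (SOME x. x \<in> X))) ` ({x. val_ge 0 x} // ?R)"
      by blast
  qed
  thus ?thesis
    using finite_residue by (rule finite_surj[rotated])
qed

text \<open>Every element is \<open>s a + \<varpi> s b\<close> for a section \<open>s\<close> of the reduction map.\<close>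

lemma finite_UNIV_intring2: "finite (UNIV :: 'a :: nonarch_local_field intring2 set)"
proof -
  define s where "s c = (SOME x :: 'a intring2. reduce x = c)" for c
  have s: "reduce (s c) = c" for c
    unfolding s_def by (rule someI_ex) (metis reduce_surj)
  have "x \<in> (\<lambda>(a, b). s a + uniformizer * s b) ` UNIV" for x :: "'a intring2"
  proof -
    have "reduce (x - s (reduce x)) = 0" by (simp add: s)
    then obtain y where y: "x - s (reduce x) = uniformizer * y"
      unfolding reduce_eq_0_iff by blast
    have "reduce (y - s (reduce y)) = 0" by (simp add: s)
    then obtain z where z: "y - s (reduce y) = uniformizer * z"
      unfolding reduce_eq_0_iff by blast
    have "y = s (reduce y) + uniformizer * z"
      using z by (simp add: algebra_simps)
    hence "uniformizer * y = uniformizer * s (reduce y)"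
      by (metis add.right_neutral distrib_left uniformizer_uniformizer_mult)
    hence "x = s (reduce x) + uniformizer * s (reduce y)"
      using y by (simp add: algebra_simps)
    thus ?thesis
      by (intro range_eqI[of _ _ "(reduce x, reduce y)"]) (unfold prod.case)
  qed
  hence "UNIV \<subseteq> (\<lambda>(a, b). s a + uniformizer * s b) ` (UNIV \<times> UNIV)" by auto
  thus ?thesis
    by (rule finite_subset) (intro finite_imageI finite_cartesian_product finite_UNIV_resfield)
qed

text \<open>The map \<open>x \<mapsto> x\<^sup>2 - x\<close> identifies \<open>0\<close> and \<open>1\<close>, so on a finite field it cannot be
  surjective. Unlike the choice of a non-square, this works in characteristic \<open>2\<close> as well.\<close>

lemma ex_quadratic_without_roots: "\<exists>d :: 'a :: nonarch_local_field resfield. \<forall>x. x * x - x \<noteq> d"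
proof (rule ccontr)
  assume "\<not> ?thesis"
  hence "surj (\<lambda>x :: 'a resfield. x * x - x)"
    unfolding surj_def by (simp add: eq_commute)
  hence "inj (\<lambda>x :: 'a resfield. x * x - x)"
    by (rule finite_UNIV_surj_inj[OF finite_UNIV_resfield])
  hence "(0 :: 'a resfield) = 1" by (rule injD) simp
  thus False by simp
qed

context
  fixes \<psi> :: "'a :: nonarch_local_field intring \<Rightarrow> complex"
  assumes \<psi>: "additive_char_conductor_p2 \<psi>"
begin

lemma char_on_intring2_to_intring2: "char_on_intring2 \<psi> (to_intring2 x) = \<psi> x"
proof -
  define x' where "x' = (SOME x'. to_intring2 x' = to_intring2 x)"
  have "to_intring2 x' = to_intring2 x"
    unfolding x'_def by (rule someI) simp
  hence "x' - x \<in> pideal 2" by (simp add: to_intring2_eq_iff)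
  hence "\<psi> (x' - x) = 1" using \<psi> by (simp add: additive_char_conductor_p2_def)
  moreover have "\<psi> (x + (x' - x)) = \<psi> x * \<psi> (x' - x)"
    using \<psi> unfolding additive_char_conductor_p2_def by blast
  ultimately show ?thesis by (simp add: char_on_intring2_def x'_def)
qed

lemma char_on_intring2_add:
  "char_on_intring2 \<psi> (x + y) = char_on_intring2 \<psi> x * char_on_intring2 \<psi> y"
proof -
  obtain x' y' where "x = to_intring2 x'" "y = to_intring2 y'" by (metis to_intring2_surj)
  thus ?thesis
    using \<psi> by (simp add: to_intring2_add [symmetric] char_on_intring2_to_intring2
        additive_char_conductor_p2_def)
qed

lemma char_on_intring2_nonzero: "char_on_intring2 \<psi> x \<noteq> 0"
proof -
  obtain x' where "x = to_intring2 x'" by (rule to_intring2_surj)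
  thus ?thesis
    using \<psi> by (simp add: char_on_intring2_to_intring2 additive_char_conductor_p2_def)
qed

lemma char_on_intring2_nontrivial: "\<exists>x. char_on_intring2 \<psi> (uniformizer * x) \<noteq> 1"
proof -
  obtain z where z: "z \<in> pideal 1" "\<psi> z \<noteq> 1"
    using \<psi> by (auto simp: additive_char_conductor_p2_def)
  then obtain x where "to_intring2 z = uniformizer * x"
    using reduce_eq_0_iff reduce_to_intring2_eq_0_iff by blast
  thus ?thesis using z(2) char_on_intring2_to_intring2[of z] by (intro exI[of _ x]) simp
qed

text \<open>The pairing of \<open>\<oo>/\<pp>\<close> with \<open>\<pp>/\<pp>\<^sup>2\<close> given by multiplication and \<open>\<psi>\<close> is nondegenerate,
  since a \<open>z\<close> with nonzero reduction is a unit.\<close>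

lemma reduce_eq_0_if_char_trivial:
  assumes "\<And>x. char_on_intring2 \<psi> (uniformizer * x * z) = 1"
  shows "reduce z = 0"
proof (rule ccontr)
  assume "reduce z \<noteq> 0"
  then obtain y where y: "z * y = 1" by (rule reduce_nonzero_unit)
  have "char_on_intring2 \<psi> (uniformizer * x) = 1" for x
    using assms[of "x * y"] y by (simp add: mult.assoc mult.left_commute mult.commute)
  thus False using char_on_intring2_nontrivial by blast
qed

end

section \<open>General linear groups and traces\<close>

lemma carrier_GL:
  "carrier (GL n) = {g \<in> carrier_mat n n. \<exists>h \<in> carrier_mat n n. h * g = 1\<^sub>m n \<and> g * h = 1\<^sub>m n}"
  by (auto simp: GL_def units_of_def Units_def ring_mat_simps)

lemma mult_GL [simp]: "mult (GL n) = (*)"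
  and one_GL [simp]: "one (GL n) = 1\<^sub>m n"
  by (simp_all add: GL_def units_of_def ring_mat_simps)

lemma group_GL: "group (GL n :: 'r :: comm_ring_1 mat monoid)"
  unfolding GL_def by (intro monoid.units_group ring.is_monoid ring_mat)

lemma inv_GL:
  fixes g :: "'r :: comm_ring_1 mat"
  assumes "g \<in> carrier (GL n)"
  shows "inv\<^bsub>GL n\<^esub> g \<in> carrier_mat n n" "g * inv\<^bsub>GL n\<^esub> g = 1\<^sub>m n" "inv\<^bsub>GL n\<^esub> g * g = 1\<^sub>m n"
  using group.inv_closed[OF group_GL assms] group.r_inv[OF group_GL assms]
    group.l_inv[OF group_GL assms]
  by (auto simp: carrier_GL)

lemma finite_carrier_mat:
  assumes "finite (UNIV :: 'a set)"
  shows "finite (carrier_mat n m :: 'a mat set)"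
proof -
  let ?I = "{..<n} \<times> {..<m}"
  have "carrier_mat n m \<subseteq> (\<lambda>f. mat n m f) ` (?I \<rightarrow>\<^sub>E (UNIV :: 'a set))"
  proof
    fix A :: "'a mat" assume "A \<in> carrier_mat n m"
    hence "A = mat n m (restrict (($$) A) ?I)" by auto
    thus "A \<in> (\<lambda>f. mat n m f) ` (?I \<rightarrow>\<^sub>E UNIV)" by (intro image_eqI) (assumption, rule restrict_PiE_iff[THEN iffD2], simp)
  qed
  moreover have "finite (?I \<rightarrow>\<^sub>E (UNIV :: 'a set))"
    using assms by (intro finite_PiE) auto
  ultimately show ?thesis by (blast intro: finite_subset)
qed

lemma less_4_iff: "(i :: nat) < 4 \<longleftrightarrow> i = 0 \<or> i = 1 \<or> i = 2 \<or> i = 3"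
  by auto

lemma sum_lessThan_4: "(\<Sum>i<4. f i) = f 0 + f 1 + f 2 + (f (3::nat) :: 'r :: comm_monoid_add)"
  by (simp add: eval_nat_numeral add.assoc)

lemma index_mult_mat_4:
  assumes "A \<in> carrier_mat 4 4" "B \<in> carrier_mat 4 4" "i < 4" "j < 4"
  shows "(A * B) $$ (i, j) = A $$ (i, 0) * B $$ (0, j) + A $$ (i, 1) * B $$ (1, j) +
    A $$ (i, 2) * B $$ (2, j) + A $$ (i, 3) * (B $$ (3, j) :: 'r :: comm_ring_1)"
  using assms by (simp add: scalar_prod_def lessThan_atLeast0 [symmetric] sum_lessThan_4)

lemma mat_trace_mult:
  assumes "A \<in> carrier_mat n m" "B \<in> carrier_mat m n"
  shows "mat_trace (A * B) = (\<Sum>i<n. \<Sum>j<m. A $$ (i, j) * B $$ (j, i))"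
  using assms by (auto simp: mat_trace_def scalar_prod_def lessThan_atLeast0 intro!: sum.cong)

lemma mat_trace_mult_commute:
  assumes "A \<in> carrier_mat n m" "B \<in> carrier_mat m n"
  shows "mat_trace (A * B) = mat_trace (B * A)"
  unfolding mat_trace_mult[OF assms] mat_trace_mult[OF assms(2,1)]
  by (subst sum.swap) (simp add: mult.commute)

section \<open>A block triangular matrix without eigenvalues\<close>

text \<open>The matrix \<open>(C J; 0 C)\<close> with \<open>C\<close> the companion matrix of \<open>x\<^sup>2 - x - d\<close> and
  \<open>J = E\<^sub>1\<^sub>1\<close>. Any \<open>J\<close> of nonzero trace would do; the usual choice, the identity matrix, has trace
  \<open>0\<close> in characteristic \<open>2\<close>.\<close>

definition orbit_mat :: "'r :: comm_ring_1 \<Rightarrow> 'r mat" where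
  "orbit_mat d = mat_of_rows_list 4
    [[0, d, 1, 0],
     [1, 1, 0, 0],
     [0, 0, 0, d],
     [0, 0, 1, 1]]"

lemma orbit_mat_carrier [simp]: "orbit_mat d \<in> carrier_mat 4 4"
  by (auto simp: orbit_mat_def mat_of_rows_list_def)

lemma orbit_mat_index [unfolded One_nat_def]:
  "orbit_mat d $$ (0, 0) = 0" "orbit_mat d $$ (0, 1) = d" "orbit_mat d $$ (0, 2) = 1" "orbit_mat d $$ (0, 3) = 0"
  "orbit_mat d $$ (1, 0) = 1" "orbit_mat d $$ (1, 1) = 1" "orbit_mat d $$ (1, 2) = 0" "orbit_mat d $$ (1, 3) = 0"
  "orbit_mat d $$ (2, 0) = 0" "orbit_mat d $$ (2, 1) = 0" "orbit_mat d $$ (2, 2) = 0" "orbit_mat d $$ (2, 3) = d"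
  "orbit_mat d $$ (3, 0) = 0" "orbit_mat d $$ (3, 1) = 0" "orbit_mat d $$ (3, 2) = 1" "orbit_mat d $$ (3, 3) = 1"
  by (simp_all add: orbit_mat_def mat_of_rows_list_def)

lemma (in comm_ring_hom) orbit_mat_hom: "map_mat hom (orbit_mat d) = orbit_mat (hom d)"
  by (rule eq_matI) (auto simp: less_4_iff orbit_mat_index carrier_matD[OF orbit_mat_carrier])

lemma companion_no_eigenvector:
  fixes d :: "'k :: field"
  assumes d: "\<And>x. x * x - x \<noteq> d"
    and "d * y = c * x" "x + y = c * y"
  shows "x = 0 \<and> y = 0"
proof -
  have x: "x = (c - 1) * y" using assms(3) by (simp add: algebra_simps)
  hence "(c * c - c - d) * y = 0" using assms(2) unfolding x by (simp add: algebra_simps)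
  hence "y = 0" using d[of c] by simp
  thus ?thesis using x by simp
qed

lemma companion_no_left_eigenvector:
  fixes d :: "'k :: field"
  assumes d: "\<And>x. x * x - x \<noteq> d"
    and "y = c * x" "d * x + y = c * y"
  shows "x = 0 \<and> y = 0"
proof -
  have "(c * c - c - d) * x = 0" using assms(2,3) by (simp add: algebra_simps)
  hence "x = 0" using d[of c] by simp
  thus ?thesis using assms by simp
qed

lemma orbit_mat_no_eigenvector:
  fixes d :: "'k :: field"
  assumes d: "\<And>x. x * x - x \<noteq> d" and g: "g \<in> carrier_mat 4 4" and h: "h \<in> carrier_mat 4 4"
    and eq: "orbit_mat d * g = g * h"
    and zero: "h $$ (1, 0) = 0" "h $$ (2, 0) = 0" "h $$ (3, 0) = 0"
    and i: "i < 4"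
  shows "g $$ (i, 0) = 0"
proof -
  have *: "(orbit_mat d * g) $$ (i, 0) = (g * h) $$ (i, 0)" for i
    by (simp only: eq)
  note 0 = *[of 0] and 1 = *[of 1] and 2 = *[of 2] and 3 = *[of 3]
  note simps = index_mult_mat_4[OF orbit_mat_carrier g] index_mult_mat_4[OF g h] orbit_mat_index zero zero[unfolded One_nat_def]
  have "g $$ (2, 0) = 0 \<and> g $$ (3, 0) = 0"
    using 2 3 by (intro companion_no_eigenvector[OF d, of _ "h $$ (0, 0)"]) (simp_all add: simps mult.commute)
  moreover from this have "g $$ (0, 0) = 0 \<and> g $$ (1, 0) = 0"
    using 0 1 by (intro companion_no_eigenvector[OF d, of _ "h $$ (0, 0)"]) (simp_all add: simps mult.commute)
  ultimately show ?thesis using i by (auto simp: less_4_iff)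
qed

lemma orbit_mat_no_left_eigenvector:
  fixes d :: "'k :: field"
  assumes d: "\<And>x. x * x - x \<noteq> d" and g: "g \<in> carrier_mat 4 4" and h: "h \<in> carrier_mat 4 4"
    and eq: "g * orbit_mat d = h * g"
    and zero: "h $$ (3, 0) = 0" "h $$ (3, 1) = 0" "h $$ (3, 2) = 0"
    and i: "i < 4"
  shows "g $$ (3, i) = 0"
proof -
  have *: "(g * orbit_mat d) $$ (3, i) = (h * g) $$ (3, i)" for i
    by (simp only: eq)
  note 0 = *[of 0] and 1 = *[of 1] and 2 = *[of 2] and 3 = *[of 3]
  note simps = index_mult_mat_4[OF g orbit_mat_carrier] index_mult_mat_4[OF h g] orbit_mat_index zero zero[unfolded One_nat_def]
  have "g $$ (3, 0) = 0 \<and> g $$ (3, 1) = 0"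
    using 0 1 by (intro companion_no_left_eigenvector[OF d, of _ "h $$ (3, 3)"]) (simp_all add: simps mult.commute)
  moreover from this have "g $$ (3, 2) = 0 \<and> g $$ (3, 3) = 0"
    using 2 3 by (intro companion_no_left_eigenvector[OF d, of _ "h $$ (3, 3)"]) (simp_all add: simps mult.commute)
  ultimately show ?thesis using i by (auto simp: less_4_iff)
qed

text \<open>In blocks, with \<open>P\<close> and \<open>R\<close> the upper and lower half of the two columns, the hypotheses are
  \<open>C P + J R = P \<gamma>\<close> and \<open>C R = R \<gamma>\<close>. If \<open>R\<close> were invertible, then \<open>J\<close> would be
  the commutator of \<open>P R\<^sup>-\<^sup>1\<close> and \<open>C\<close> and have trace \<open>0\<close>; but its trace is \<open>1\<close>. If
  \<open>R\<close> had rank \<open>1\<close>, its image would be spanned by an eigenvector of \<open>C\<close>.\<close>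

lemma orbit_mat_invariant_plane_aux:
  fixes d :: "'k :: field"
  assumes d: "\<And>x. x * x - x \<noteq> d"
    and top: "d * p10 + r00 = p00 * a + p01 * c" "d * p11 + r01 = p00 * b + p01 * e"
      "p00 + p10 = p10 * a + p11 * c" "p01 + p11 = p10 * b + p11 * e"
    and bot: "d * r10 = r00 * a + r01 * c" "d * r11 = r00 * b + r01 * e"
      "r00 + r10 = r10 * a + r11 * c" "r01 + r11 = r10 * b + r11 * e"
  shows "r00 = 0 \<and> r01 = 0 \<and> r10 = 0 \<and> r11 = 0"
proof -
  define D where "D = r00 * r11 - r01 * r10"
  \<comment> \<open>Cramer's rule for \<open>R \<gamma> = C R\<close>\<close>
  have Da: "D * a = r11 * (d * r10) - r01 * (r00 + r10)"
    and Db: "D * b = r11 * (d * r11) - r01 * (r01 + r11)"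
    and Dc: "D * c = r00 * (r00 + r10) - r10 * (d * r10)"
    and De: "D * e = r00 * (r01 + r11) - r10 * (d * r11)"
    unfolding bot D_def by (simp_all add: algebra_simps)
  \<comment> \<open>\<open>det R\<close> times the trace of \<open>(C P + J R) adj R = P \<gamma> adj R\<close>; the part from \<open>J\<close> is \<open>D * D\<close>\<close>
  have "D * ((d * p10 + r00) * r11 - (d * p11 + r01) * r10 - (p00 + p10) * r01 + (p01 + p11) * r00) =
      p00 * ((D * a) * r11 - (D * b) * r10) + p01 * ((D * c) * r11 - (D * e) * r10) +
      p10 * ((D * b) * r00 - (D * a) * r01) + p11 * ((D * e) * r00 - (D * c) * r01)"
    unfolding top by (simp add: algebra_simps)
  hence "D * D = 0"
    unfolding Da Db Dc De by (simp add: D_def algebra_simps)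
  hence D: "r00 * r11 = r01 * r10" by (simp add: D_def)
  have "r00 = 0 \<and> r10 = 0"
  proof (rule ccontr)
    assume nz: "\<not> (r00 = 0 \<and> r10 = 0)"
    have "\<exists>l. r01 = l * r00 \<and> r11 = l * r10"
    proof (cases "r00 = 0")
      case False
      thus ?thesis using D by (intro exI[of _ "r01 / r00"]) (simp add: field_simps)
    next
      case True
      hence "r10 \<noteq> 0" using nz by simp
      thus ?thesis using D True by (intro exI[of _ "r11 / r10"]) (simp add: field_simps)
    qed
    then obtain l where "r01 = l * r00" "r11 = l * r10" by blast
    hence "r00 = 0 \<and> r10 = 0"
      using bot by (intro companion_no_eigenvector[OF d, of _ "a + l * c"]) (simp_all add: algebra_simps)
    thus False using nz by blast
  qed
  moreover from this have "r01 = 0 \<and> r11 = 0"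
    using bot by (intro companion_no_eigenvector[OF d, of _ e]) (simp_all add: algebra_simps)
  ultimately show ?thesis by blast
qed

text \<open>The hypotheses on \<open>h\<close> say that the first two columns of \<open>g\<close> span a plane that is invariant
  under \<open>orbit_mat d\<close>, up to a possible drop of rank.\<close>

lemma orbit_mat_invariant_plane:
  fixes d :: "'k :: field"
  assumes d: "\<And>x. x * x - x \<noteq> d" and g: "g \<in> carrier_mat 4 4" and h: "h \<in> carrier_mat 4 4"
    and eq: "orbit_mat d * g = g * h"
    and zero: "h $$ (2, 0) = 0" "h $$ (2, 1) = 0" "h $$ (3, 0) = 0" "h $$ (3, 1) = 0"
  shows "g $$ (2, 0) = 0 \<and> g $$ (2, 1) = 0 \<and> g $$ (3, 0) = 0 \<and> g $$ (3, 1) = 0"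
proof -
  have *: "(orbit_mat d * g) $$ (i, j) = (g * h) $$ (i, j)" for i j
    by (simp only: eq)
  note simps = index_mult_mat_4[OF orbit_mat_carrier g] index_mult_mat_4[OF g h] orbit_mat_index zero zero[unfolded One_nat_def]
  show ?thesis
    using *[of 0 0] *[of 0 1] *[of 1 0] *[of 1 1] *[of 2 0] *[of 2 1] *[of 3 0] *[of 3 1]
    by (intro orbit_mat_invariant_plane_aux[OF d, where a = "h $$ (0, 0)" and b = "h $$ (0, 1)"
          and c = "h $$ (1, 0)" and e = "h $$ (1, 1)" and ?p00.0 = "g $$ (0, 0)" and ?p01.0 = "g $$ (0, 1)"
          and ?p10.0 = "g $$ (1, 0)" and ?p11.0 = "g $$ (1, 1)"]) (simp_all add: simps)
qed

text \<open>The polynomial \<open>p\<close> is the characteristic polynomial of the diagonal block \<open>C\<close>.\<close>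

lemma char_poly_orbit_mat:
  fixes d :: "'k :: field"
  shows "\<exists>p. degree p = 2 \<and> char_poly (orbit_mat d) = p * p"
proof -
  define C :: "'k mat" where "C = mat_of_rows_list 2 [[0, d], [1, 1]]"
  have C [simp]: "C \<in> carrier_mat 2 2" by (auto simp: C_def mat_of_rows_list_def)
  define J :: "'k poly mat" where "J = mat_of_rows_list 2 [[-1, 0], [0, 0]]"
  have J [simp]: "J \<in> carrier_mat 2 2" by (auto simp: J_def mat_of_rows_list_def)
  have "char_poly_matrix (orbit_mat d) = four_block_mat (char_poly_matrix C) J (0\<^sub>m 2 2) (char_poly_matrix C)"
    by (rule eq_matI)
      (auto simp: less_4_iff char_poly_matrix_def orbit_mat_index carrier_matD[OF orbit_mat_carrier]
        carrier_matD[OF C] carrier_matD[OF J], simp_all add: C_def J_def mat_of_rows_list_def one_pCons)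
  hence "char_poly (orbit_mat d) = char_poly C * char_poly C"
    unfolding char_poly_def
    by (simp add: det_four_block_mat_lower_left_zero[of _ 2 _ 2] char_poly_matrix_closed)
  moreover have "degree (char_poly C) = 2"
    using degree_monic_char_poly[OF C] by simp
  ultimately show ?thesis by blast
qed

lemma not_irreducible_char_poly_orbit_mat:
  fixes d :: "'k :: field"
  shows "\<not> irreducible (char_poly (orbit_mat d))"
proof
  assume irr: "irreducible (char_poly (orbit_mat d))"
  obtain p where p: "degree p = 2" "char_poly (orbit_mat d) = p * p"
    using char_poly_orbit_mat by blast
  hence "p dvd 1" using irreducibleD[OF irr p(2)] by blast
  thus False using p(1) by (auto simp: poly_dvd_1)
qed

section \<open>A character extending the character of the congruence subgroup\<close>

text \<open>The matrix \<open>1 + y N\<close>, where \<open>N\<close> has the identity matrix as its upper right block.\<close>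

definition unipotent :: "'r :: comm_ring_1 \<Rightarrow> 'r mat" where
  "unipotent y = mat 4 4 (\<lambda>(i, j). if i = j then 1 else if j = i + 2 then y else 0)"

lemma unipotent_carrier [simp]: "unipotent y \<in> carrier_mat 4 4"
  by (simp add: unipotent_def)

lemma unipotent_index:
  assumes "i < 4" "j < 4"
  shows "unipotent y $$ (i, j) = (if i = j then 1 else if j = i + 2 then y else 0)"
  using assms by (simp add: unipotent_def)

lemma unipotent_0: "unipotent 0 = 1\<^sub>m 4"
  by (rule eq_matI) (auto simp: unipotent_def)

lemma unipotent_mult: "unipotent x * unipotent y = unipotent (x + y)"
proof (rule eq_matI)
  fix i j assume "i < dim_row (unipotent (x + y))" "j < dim_col (unipotent (x + y))"
  hence "i < 4" "j < 4" by (auto simp: unipotent_def)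
  thus "(unipotent x * unipotent y) $$ (i, j) = unipotent (x + y) $$ (i, j)"
    unfolding index_mult_mat_4[OF unipotent_carrier unipotent_carrier \<open>i < 4\<close> \<open>j < 4\<close>]
    unfolding less_4_iff by (elim disjE; simp add: unipotent_index)
qed (auto simp: unipotent_def)

lemma unipotent_GL: "unipotent y \<in> carrier (GL 4)"
  unfolding carrier_GL using unipotent_mult[of y "- y"] unipotent_mult[of "- y" y]
  by (auto simp: unipotent_0 intro!: bexI[of _ "unipotent (- y)"])

text \<open>The group \<open>H\<close>, the preimage of all \<open>1 + y N\<close> over the residue field. The value of \<open>y\<close> can be
  read off from the entry \<open>(0, 2)\<close>.\<close>

definition unipotent_preimage :: "'a :: nonarch_local_field intring2 mat set" where
  "unipotent_preimage = {h \<in> carrier (GL 4). map_mat reduce h = unipotent (reduce (h $$ (0, 2)))}"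

lemma carrier_GL_carrier_mat: "g \<in> carrier (GL n) \<Longrightarrow> g \<in> carrier_mat n n"
  by (simp add: carrier_GL)

lemma unipotent_preimage_carrier: "h \<in> unipotent_preimage \<Longrightarrow> h \<in> carrier_mat 4 4"
  by (simp add: unipotent_preimage_def carrier_GL_carrier_mat)

lemma unipotent_preimageI:
  assumes "h \<in> carrier (GL 4)" "map_mat reduce h = unipotent y"
  shows "h \<in> unipotent_preimage"
proof -
  have "reduce (h $$ (0, 2)) = map_mat reduce h $$ (0, 2)"
    using carrier_GL_carrier_mat[OF assms(1)] by simp
  also have "\<dots> = y" by (simp add: assms(2) unipotent_index)
  finally show ?thesis using assms by (simp add: unipotent_preimage_def)
qed

lemma map_reduce_mult:
  "A \<in> carrier_mat 4 4 \<Longrightarrow> B \<in> carrier_mat 4 4 \<Longrightarrow>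
    map_mat reduce (A * B) = map_mat reduce A * map_mat reduce B"
  by (rule reduce.mat_hom_mult)

lemma subgroup_unipotent_preimage: "subgroup unipotent_preimage (GL 4 :: 'a :: nonarch_local_field intring2 mat monoid)"
proof (rule group.subgroupI[OF group_GL])
  show "unipotent_preimage \<subseteq> carrier (GL 4 :: 'a intring2 mat monoid)" by (auto simp: unipotent_preimage_def)
  have "1\<^sub>m 4 \<in> (unipotent_preimage :: 'a intring2 mat set)"
    using monoid.one_closed[OF group.is_monoid[OF group_GL[of 4, where 'r = "'a intring2"]]]
    by (intro unipotent_preimageI[of _ 0]) (simp_all add: unipotent_0 reduce.mat_hom_one)
  thus "(unipotent_preimage :: 'a intring2 mat set) \<noteq> {}" by blast
next
  fix h :: "'a intring2 mat" assume h: "h \<in> unipotent_preimage"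
  hence hG: "h \<in> carrier (GL 4)" by (simp add: unipotent_preimage_def)
  define y where "y = reduce (h $$ (0, 2))"
  have y: "map_mat reduce h = unipotent y" using h by (simp add: unipotent_preimage_def y_def)
  let ?k = "inv\<^bsub>GL 4\<^esub> h"
  note k = inv_GL[OF hG]
  have k': "map_mat reduce ?k \<in> carrier_mat 4 4" using k(1) by simp
  have "unipotent y * map_mat reduce ?k = 1\<^sub>m 4"
    using map_reduce_mult[OF unipotent_preimage_carrier[OF h] k(1)] k(2) y by (simp add: reduce.mat_hom_one)
  hence "unipotent (- y) * (unipotent y * map_mat reduce ?k) = unipotent (- y)"
    by (simp add: right_mult_one_mat[OF unipotent_carrier])
  hence "map_mat reduce ?k = unipotent (- y)"
    by (simp add: assoc_mult_mat[OF unipotent_carrier unipotent_carrier k', symmetric]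
        unipotent_mult unipotent_0 left_mult_one_mat[OF k'])
  thus "?k \<in> unipotent_preimage"
    by (rule unipotent_preimageI[OF group.inv_closed[OF group_GL hG]])
next
  fix h k :: "'a intring2 mat" assume hk: "h \<in> unipotent_preimage" "k \<in> unipotent_preimage"
  have "map_mat reduce (h * k) = unipotent (reduce (h $$ (0, 2)) + reduce (k $$ (0, 2)))"
    using hk by (simp add: map_reduce_mult unipotent_preimage_carrier unipotent_mult [symmetric]) (simp add: unipotent_preimage_def)
  moreover have "h * k \<in> carrier (GL 4)"
    using monoid.m_closed[OF group.is_monoid[OF group_GL], of h 4 k] hk by (simp add: unipotent_preimage_def)
  ultimately show "h \<otimes>\<^bsub>GL 4\<^esub> k \<in> unipotent_preimage" by (auto intro: unipotent_preimageI)
qed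

lemma K1_eq: "K1 = {k \<in> carrier (GL 4). map_mat reduce k = 1\<^sub>m 4}"
  by (simp add: K1_def kernel_def)

lemma K1_subset_unipotent_preimage: "K1 \<subseteq> unipotent_preimage"
  by (auto simp: K1_eq unipotent_0 intro: unipotent_preimageI[of _ 0])

lemma reduce_mult_eq_0: "reduce x = 0 \<Longrightarrow> reduce y = 0 \<Longrightarrow> x * y = 0"
  by (auto simp: reduce_eq_0_iff mult.assoc mult.left_commute)

text \<open>Invertibility comes for free: \<open>k = 1 + E\<close> with the entries of \<open>E\<close> in \<open>\<pp>/\<pp>\<^sup>2\<close>,
  so that \<open>E\<^sup>2 = 0\<close> and \<open>1 - E\<close> is the inverse.\<close>

lemma K1I:
  fixes k :: "'a :: nonarch_local_field intring2 mat"
  assumes k: "k \<in> carrier_mat 4 4" and red: "map_mat reduce k = 1\<^sub>m 4"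
  shows "k \<in> K1"
proof -
  define E where "E = k - 1\<^sub>m 4"
  have E: "E \<in> carrier_mat 4 4" using k by (simp add: E_def minus_carrier_mat)
  have red_E: "reduce (E $$ (i, j)) = 0" if "i < 4" "j < 4" for i j
  proof -
    have "reduce (k $$ (i, j)) = map_mat reduce k $$ (i, j)"
      using k that by simp
    thus ?thesis using k that by (simp add: E_def red)
  qed
  have EE: "E * E = 0\<^sub>m 4 4"
    by (rule eq_matI)
      (use E in \<open>auto simp: index_mult_mat_4[OF E E] reduce_mult_eq_0 red_E simp del: index_mult_mat(1)\<close>)
  have k_eq: "k = 1\<^sub>m 4 + E" using k by (auto simp: E_def)
  have E': "1\<^sub>m 4 - E \<in> carrier_mat 4 4" using E by (simp add: minus_carrier_mat)
  have "(1\<^sub>m 4 + E) * (1\<^sub>m 4 - E) = (1\<^sub>m 4 - E) + (E - E * E)"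
    using E E' by (simp add: add_mult_distrib_mat[OF _ E E'] mult_minus_distrib_mat[OF E _ E])
  hence 1: "(1\<^sub>m 4 + E) * (1\<^sub>m 4 - E) = 1\<^sub>m 4"
    unfolding EE using E by (auto intro!: eq_matI)
  have "(1\<^sub>m 4 - E) * (1\<^sub>m 4 + E) = (1\<^sub>m 4 + E) - (E + E * E)"
    using E by (simp add: minus_mult_distrib_mat[OF _ E add_carrier_mat[OF E]] mult_add_distrib_mat[OF E _ E])
  hence 2: "(1\<^sub>m 4 - E) * (1\<^sub>m 4 + E) = 1\<^sub>m 4"
    unfolding EE using E by (auto intro!: eq_matI)
  have "k \<in> carrier (GL 4)"
    unfolding carrier_GL k_eq using 1 2 E E'
    by (intro CollectI conjI bexI[of _ "1\<^sub>m 4 - E"]) simp_all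
  thus ?thesis using red by (simp add: K1_eq)
qed

text \<open>If \<open>h = 1 + a N + E\<close> with \<open>a = h\<^sub>0\<^sub>2\<close>, and \<open>B\<close> stands for \<open>orbit_mat d\<close>, this is
  \<open>\<varpi> a + Tr (B (k - 1))\<close> for \<open>k = h (1 - a N) \<in> K\<^sub>1\<close>, written out in the entries of \<open>h\<close>: the sum in
  the first parentheses is \<open>Tr (B E)\<close> and that in the last ones is \<open>Tr (B N E)\<close>.\<close>

definition theta_exponent :: "'a :: nonarch_local_field intring2 \<Rightarrow> 'a intring2 mat \<Rightarrow> 'a intring2" where
  "theta_exponent d h = uniformizer * h $$ (0, 2) + (d * h $$ (1, 0) + h $$ (2, 0) + h $$ (0, 1) + (h $$ (1, 1) - 1) +
     d * h $$ (3, 2) + h $$ (2, 3) + (h $$ (3, 3) - 1))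
     - h $$ (0, 2) * (d * h $$ (3, 0) + h $$ (2, 1) + h $$ (3, 1))"

lemma unipotent_preimage_index:
  assumes h: "h \<in> unipotent_preimage"
  obtains a e where "\<forall>i<4. \<forall>j<4. h $$ (i, j) = unipotent a $$ (i, j) + uniformizer * e i j" "e 0 2 = 0"
    "h $$ (0, 2) = a"
proof -
  define a where "a = h $$ (0, 2)"
  define P where "P i j x \<longleftrightarrow> (i < 4 \<longrightarrow> j < 4 \<longrightarrow> h $$ (i, j) = unipotent a $$ (i, j) + uniformizer * x) \<and>
      ((i, j) = (0, 2) \<longrightarrow> x = 0)" for i j x
  have ex: "\<exists>x. P i j x" for i j
  proof (cases "i < 4 \<and> j < 4 \<and> (i, j) \<noteq> (0, 2)")
    case True
    have "reduce (h $$ (i, j)) = map_mat reduce h $$ (i, j)"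
      using True unipotent_preimage_carrier[OF h] by simp
    also have "\<dots> = reduce (unipotent a $$ (i, j))"
      using h True by (simp add: unipotent_preimage_def a_def unipotent_index)
    finally have "reduce (h $$ (i, j) - unipotent a $$ (i, j)) = 0" by simp
    then obtain x where "h $$ (i, j) - unipotent a $$ (i, j) = uniformizer * x"
      unfolding reduce_eq_0_iff by blast
    hence "h $$ (i, j) = unipotent a $$ (i, j) + uniformizer * x" by (simp add: algebra_simps)
    thus ?thesis using True unfolding P_def by blast
  next
    case False
    thus ?thesis by (intro exI[of _ 0]) (auto simp: P_def a_def unipotent_index)
  qed
  define e where "e i j = (SOME x. P i j x)" for i j
  have e: "P i j (e i j)" for i j
    unfolding e_def by (rule someI_ex[OF ex])
  show ?thesis
  proof (rule that[of a e])
    show "\<forall>i<4. \<forall>j<4. h $$ (i, j) = unipotent a $$ (i, j) + uniformizer * e i j"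
      using e unfolding P_def by blast
    show "e 0 2 = 0" using e[of 0 2] unfolding P_def by blast
  qed (simp add: a_def)
qed

text \<open>Multiplying out \<open>(1 + a N + E) (1 + b N + F)\<close> and dropping \<open>N\<^sup>2 = 0\<close> and \<open>E F = 0\<close>
  leaves \<open>1 + (a + b) N + (E + F + a N F + b E N)\<close>. As \<open>B\<close> and \<open>N\<close> commute, \<open>Tr (B E N) = Tr (B N E)\<close>, and
  the mixed terms \<open>a Tr (B N F)\<close> and \<open>b Tr (B N E)\<close> cancel. The proof performs this computation in the entries.\<close>

lemma theta_exponent_mult:
  assumes h: "h \<in> unipotent_preimage" and k: "k \<in> unipotent_preimage"
  shows "theta_exponent d (h * k) = theta_exponent d h + theta_exponent d k"
proof -
  obtain a e where e: "\<forall>i<4. \<forall>j<4. h $$ (i, j) = unipotent a $$ (i, j) + uniformizer * e i j"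
    "e 0 2 = 0" "h $$ (0, 2) = a"
    by (rule unipotent_preimage_index[OF h])
  obtain b f where f: "\<forall>i<4. \<forall>j<4. k $$ (i, j) = unipotent b $$ (i, j) + uniformizer * f i j"
    "f 0 2 = 0" "k $$ (0, 2) = b"
    by (rule unipotent_preimage_index[OF k])
  have e': "h $$ (0, 0) = 1 + uniformizer * e 0 0" "h $$ (0, 1) = uniformizer * e 0 1" "h $$ (0, 3) = uniformizer * e 0 3"
    "h $$ (1, 0) = uniformizer * e 1 0" "h $$ (1, 1) = 1 + uniformizer * e 1 1" "h $$ (1, 2) = uniformizer * e 1 2" "h $$ (1, 3) = a + uniformizer * e 1 3"
    "h $$ (2, 0) = uniformizer * e 2 0" "h $$ (2, 1) = uniformizer * e 2 1" "h $$ (2, 2) = 1 + uniformizer * e 2 2" "h $$ (2, 3) = uniformizer * e 2 3"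
    "h $$ (3, 0) = uniformizer * e 3 0" "h $$ (3, 1) = uniformizer * e 3 1" "h $$ (3, 2) = uniformizer * e 3 2" "h $$ (3, 3) = 1 + uniformizer * e 3 3"
    by (simp_all add: e(1) unipotent_index)
  have f': "k $$ (0, 0) = 1 + uniformizer * f 0 0" "k $$ (0, 1) = uniformizer * f 0 1" "k $$ (0, 3) = uniformizer * f 0 3"
    "k $$ (1, 0) = uniformizer * f 1 0" "k $$ (1, 1) = 1 + uniformizer * f 1 1" "k $$ (1, 2) = uniformizer * f 1 2" "k $$ (1, 3) = b + uniformizer * f 1 3"
    "k $$ (2, 0) = uniformizer * f 2 0" "k $$ (2, 1) = uniformizer * f 2 1" "k $$ (2, 2) = 1 + uniformizer * f 2 2" "k $$ (2, 3) = uniformizer * f 2 3"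
    "k $$ (3, 0) = uniformizer * f 3 0" "k $$ (3, 1) = uniformizer * f 3 1" "k $$ (3, 2) = uniformizer * f 3 2" "k $$ (3, 3) = 1 + uniformizer * f 3 3"
    by (simp_all add: f(1) unipotent_index)
  define p :: "'a intring2" where "p = uniformizer"
  have pp: "p * p = 0" "\<And>x. p * (p * x) = 0" by (simp_all add: p_def)
  have num: "(0::nat) < 4" "(1::nat) < 4" "(2::nat) < 4" "(3::nat) < 4" by simp_all
  note mult = index_mult_mat_4[OF unipotent_preimage_carrier[OF h] unipotent_preimage_carrier[OF k]]
  show ?thesis
    unfolding theta_exponent_def mult[OF num(1) num(3)] mult[OF num(2) num(1)] mult[OF num(3) num(1)]
      mult[OF num(1) num(2)] mult[OF num(2) num(2)] mult[OF num(4) num(3)] mult[OF num(3) num(4)]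
      mult[OF num(4) num(4)] mult[OF num(4) num(1)] mult[OF num(3) num(2)] mult[OF num(4) num(2)]
      e(3) f(3) e' f' p_def [symmetric]
    by (simp add: algebra_simps pp)
qed

lemma K1_carrier: "k \<in> K1 \<Longrightarrow> k \<in> carrier_mat 4 4"
  by (simp add: K1_eq carrier_GL_carrier_mat)

lemma reduce_K1:
  assumes "k \<in> K1" "i < 4" "j < 4"
  shows "reduce (k $$ (i, j)) = (if i = j then 1 else 0)"
proof -
  have "reduce (k $$ (i, j)) = map_mat reduce k $$ (i, j)"
    using assms K1_carrier by force
  thus ?thesis using assms by (simp add: K1_eq)
qed

text \<open>On \<open>K\<^sub>1\<close> the exponent is that of \<open>\<psi>\<^sub>\<beta>\<close>, for any choice of the lift \<open>B\<close> of \<open>\<beta>\<close>.\<close>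

lemma trace_K1:
  fixes d :: "'a :: nonarch_local_field intring2"
  assumes k: "k \<in> K1" and B: "B \<in> carrier_mat 4 4" "map_mat reduce B = orbit_mat (reduce d)"
  shows "mat_trace (B * (k - 1\<^sub>m 4)) = theta_exponent d k"
proof -
  note kc = K1_carrier[OF k]
  have k1: "k - 1\<^sub>m 4 \<in> carrier_mat 4 4" by (simp add: minus_carrier_mat)
  have *: "B $$ (i, j) * (k - 1\<^sub>m 4) $$ (j, i) = orbit_mat d $$ (i, j) * (k - 1\<^sub>m 4) $$ (j, i)"
    if "i < 4" "j < 4" for i j
  proof -
    have "reduce (B $$ (i, j)) = map_mat reduce B $$ (i, j)" using B(1) that by simp
    also have "\<dots> = map_mat reduce (orbit_mat d) $$ (i, j)"
      by (simp only: B(2) reduce.orbit_mat_hom)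
    also have "\<dots> = reduce (orbit_mat d $$ (i, j))"
      using that carrier_matD[OF orbit_mat_carrier[of d]] by simp
    finally have "reduce (B $$ (i, j) - orbit_mat d $$ (i, j)) = 0" by simp
    moreover have "reduce ((k - 1\<^sub>m 4) $$ (j, i)) = 0"
      using that kc by (simp add: reduce_K1[OF k])
    ultimately have "(B $$ (i, j) - orbit_mat d $$ (i, j)) * (k - 1\<^sub>m 4) $$ (j, i) = 0"
      by (rule reduce_mult_eq_0)
    thus ?thesis by (simp add: left_diff_distrib)
  qed
  have z: "uniformizer * k $$ (0, 2) = 0" "k $$ (0, 2) * k $$ (3, 0) = 0" "k $$ (0, 2) * k $$ (2, 1) = 0"
      "k $$ (0, 2) * k $$ (3, 1) = 0"
    by (rule reduce_mult_eq_0; simp add: reduce_K1[OF k])+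
  have "k $$ (0, 2) * (d * k $$ (3, 0) + k $$ (2, 1) + k $$ (3, 1)) =
      d * (k $$ (0, 2) * k $$ (3, 0)) + k $$ (0, 2) * k $$ (2, 1) + k $$ (0, 2) * k $$ (3, 1)"
    by (simp only: distrib_left mult.left_commute)
  hence z': "k $$ (0, 2) * (d * k $$ (3, 0) + k $$ (2, 1) + k $$ (3, 1)) = 0"
    by (simp only: z mult_zero_right add_0_right)
  have "mat_trace (B * (k - 1\<^sub>m 4)) = (\<Sum>i<4. \<Sum>j<4. orbit_mat d $$ (i, j) * (k - 1\<^sub>m 4) $$ (j, i))"
    unfolding mat_trace_mult[OF B(1) k1] by (intro sum.cong refl *) auto
  also have "\<dots> = theta_exponent d k"
    unfolding theta_exponent_def z(1) z' sum_lessThan_4 using kc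
    by (simp add: orbit_mat_index algebra_simps)
  finally show ?thesis .
qed

lemma addrow_mat_K1:
  assumes "i \<noteq> j"
  shows "addrow_mat 4 (uniformizer * x) i j \<in> K1"
  by (rule K1I) (auto simp: intro!: eq_matI)

lemma K1_normal:
  assumes g: "g \<in> carrier (GL 4)" and u: "u \<in> K1"
  shows "g * u * inv\<^bsub>GL 4\<^esub> g \<in> K1"
proof (rule K1I)
  note gi = inv_GL[OF g] and gc = carrier_GL_carrier_mat[OF g] and uc = K1_carrier[OF u]
  note gu = mult_carrier_mat[OF gc uc]
  show "g * u * inv\<^bsub>GL 4\<^esub> g \<in> carrier_mat 4 4"
    by (rule mult_carrier_mat[OF gu gi(1)])
  have "map_mat reduce (g * u * inv\<^bsub>GL 4\<^esub> g) = map_mat reduce (g * inv\<^bsub>GL 4\<^esub> g)"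
    using u gc by (simp add: map_reduce_mult[OF gu gi(1)] map_reduce_mult[OF gc uc]
        map_reduce_mult[OF gc gi(1)] K1_eq)
  thus "map_mat reduce (g * u * inv\<^bsub>GL 4\<^esub> g) = 1\<^sub>m 4"
    by (simp add: gi reduce.mat_hom_one)
qed

text \<open>By cyclicity of the trace, with \<open>addrow_mat 4 (\<varpi> x) i j = 1 + \<varpi> x E\<^sub>i\<^sub>j\<close>:
  \<open>Tr (B g E\<^sub>i\<^sub>j g\<^sup>-\<^sup>1) = Tr (g\<^sup>-\<^sup>1 B g E\<^sub>i\<^sub>j)\<close>.\<close>

lemma theta_exponent_conj_addrow_mat:
  fixes d x :: "'a :: nonarch_local_field intring2"
  assumes g: "g \<in> carrier (GL 4)" and ij: "i < 4" "j < 4" "i \<noteq> j"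
  shows "theta_exponent d (g * addrow_mat 4 (uniformizer * x) i j * inv\<^bsub>GL 4\<^esub> g) =
    uniformizer * x * (inv\<^bsub>GL 4\<^esub> g * orbit_mat d * g) $$ (j, i)"
proof -
  let ?u = "addrow_mat 4 (uniformizer * x) i j"
  define X where "X = mat 4 4 (\<lambda>kl. if kl = (i, j) then uniformizer * x else 0)"
  define h where "h = inv\<^bsub>GL 4\<^esub> g"
  note h = inv_GL[OF g, folded h_def] and gc = carrier_GL_carrier_mat[OF g]
  have Xc: "X \<in> carrier_mat 4 4" by (simp add: X_def)
  have u: "?u = 1\<^sub>m 4 + X"
    using ij by (intro eq_matI) (auto simp: X_def)
  note gX = mult_carrier_mat[OF gc Xc]
  note gXh = mult_carrier_mat[OF gX h(1)]
  note Bg = mult_carrier_mat[OF orbit_mat_carrier gc, of d]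
  note hB = mult_carrier_mat[OF h(1) orbit_mat_carrier, of d]
  note Xh = mult_carrier_mat[OF Xc h(1)]
  have cancel: "1\<^sub>m 4 + M - 1\<^sub>m 4 = M" if "M \<in> carrier_mat 4 4" for M :: "'a intring2 mat"
    using that by auto
  have "g * ?u * h = 1\<^sub>m 4 + g * X * h"
    unfolding u using gc by (simp add: mult_add_distrib_mat[OF gc _ Xc] add_mult_distrib_mat[OF gc gX h(1)] h)
  hence "g * ?u * h - 1\<^sub>m 4 = g * X * h"
    using cancel[OF gXh] by simp
  moreover have "mat_trace (orbit_mat d * (g * ?u * h - 1\<^sub>m 4)) = theta_exponent d (g * ?u * h)"
    unfolding h_def
    by (rule trace_K1[OF K1_normal[OF g addrow_mat_K1[OF ij(3)]] orbit_mat_carrier reduce.orbit_mat_hom])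
  ultimately have "theta_exponent d (g * ?u * h) = mat_trace (orbit_mat d * (g * X * h))" by simp
  also have "orbit_mat d * (g * X * h) = (orbit_mat d * g) * (X * h)"
    by (simp add: assoc_mult_mat[OF gc Xc h(1)] assoc_mult_mat[OF orbit_mat_carrier gc Xh])
  also have "mat_trace \<dots> = mat_trace (X * h * (orbit_mat d * g))"
    by (rule mat_trace_mult_commute[OF Bg Xh])
  also have "X * h * (orbit_mat d * g) = X * (h * orbit_mat d * g)"
    by (simp add: assoc_mult_mat[OF Xc h(1) Bg] assoc_mult_mat[OF h(1) orbit_mat_carrier gc])
  also have "mat_trace \<dots> = (\<Sum>k<4. \<Sum>l<4. X $$ (k, l) * (h * orbit_mat d * g) $$ (l, k))"
    by (rule mat_trace_mult[OF Xc mult_carrier_mat[OF hB gc]])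
  also have "\<dots> = (\<Sum>k<4. \<Sum>l<4. if l = j then if k = i then uniformizer * x * (h * orbit_mat d * g) $$ (j, i) else 0 else 0)"
    by (intro sum.cong refl) (auto simp: X_def simp del: index_mult_mat)
  also have "\<dots> = uniformizer * x * (h * orbit_mat d * g) $$ (j, i)"
    using ij by (simp del: index_mult_mat)
  finally show ?thesis by (simp only: h_def)
qed

lemma reduce_conj:
  fixes d :: "'a :: nonarch_local_field intring2"
  assumes g: "g \<in> carrier (GL 4)"
  defines "h \<equiv> inv\<^bsub>GL 4\<^esub> g"
  shows "orbit_mat (reduce d) * map_mat reduce g = map_mat reduce g * map_mat reduce (h * orbit_mat d * g)"
    and "map_mat reduce h * orbit_mat (reduce d) = map_mat reduce (h * orbit_mat d * g) * map_mat reduce h"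
proof -
  note h = inv_GL[OF g, folded h_def] and gc = carrier_GL_carrier_mat[OF g]
  note Bg = mult_carrier_mat[OF orbit_mat_carrier gc, of d]
  note hB = mult_carrier_mat[OF h(1) orbit_mat_carrier, of d]
  note hBg = mult_carrier_mat[OF hB gc]
  have "g * (h * orbit_mat d * g) = g * h * (orbit_mat d * g)"
    by (simp add: assoc_mult_mat[OF h(1) orbit_mat_carrier gc] assoc_mult_mat[OF gc h(1) Bg])
  hence "g * (h * orbit_mat d * g) = orbit_mat d * g"
    by (simp only: h left_mult_one_mat[OF Bg])
  from arg_cong[OF this, of "map_mat reduce"]
  show "orbit_mat (reduce d) * map_mat reduce g = map_mat reduce g * map_mat reduce (h * orbit_mat d * g)"
    by (simp add: map_reduce_mult[OF gc hBg] map_reduce_mult[OF orbit_mat_carrier gc] reduce.orbit_mat_hom)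
  have "h * orbit_mat d * g * h = h * orbit_mat d * (g * h)"
    by (rule assoc_mult_mat[OF hB gc h(1)])
  hence "h * orbit_mat d * g * h = h * orbit_mat d"
    by (simp only: h right_mult_one_mat[OF hB])
  from arg_cong[OF this, of "map_mat reduce"]
  show "map_mat reduce h * orbit_mat (reduce d) = map_mat reduce (h * orbit_mat d * g) * map_mat reduce h"
    by (simp add: map_reduce_mult[OF hBg h(1)] map_reduce_mult[OF h(1) orbit_mat_carrier] reduce.orbit_mat_hom)
qed

section \<open>Unipotent subgroups\<close>

text \<open>The lower right block of \<open>A\<close> is invertible, with inverse the lower right block of \<open>B\<close>, and it
  annihilates the lower left block of \<open>B\<close>. Over a ring, invertibility is used through the determinant \<open>D\<close>.\<close>

lemma block_upper_inverse:
  fixes A B :: "'r :: comm_ring_1 mat"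
  assumes A: "A \<in> carrier_mat 4 4" and B: "B \<in> carrier_mat 4 4" and AB: "A * B = 1\<^sub>m 4"
    and zero: "\<And>i j. i \<in> {2, 3} \<Longrightarrow> j \<in> {0, 1} \<Longrightarrow> A $$ (i, j) = 0"
    and i: "i \<in> {2, 3}" and j: "j \<in> {0, 1}"
  shows "B $$ (i, j) = 0"
proof -
  have *: "(A * B) $$ (i, j) = (if i = j then 1 else 0)" if "i < 4" "j < 4" for i j
    using that by (simp add: AB)
  have z: "A $$ (2, 0) = 0" "A $$ (2, 1) = 0" "A $$ (3, 0) = 0" "A $$ (3, 1) = 0"
    by (simp_all add: zero)
  define s t where "s i j = A $$ (i, j)" and "t i j = B $$ (i, j)" for i j
  have eq: "s 2 2 * t 2 j + s 2 3 * t 3 j = (if j = 2 then 1 else 0)"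
    "s 3 2 * t 2 j + s 3 3 * t 3 j = (if j = 3 then 1 else 0)" if "j < 4" for j
    using *[of 2 j] *[of 3 j] that
    unfolding index_mult_mat_4[OF A B, of 2 j, OF _ that, simplified] index_mult_mat_4[OF A B, of 3 j, OF _ that, simplified]
    by (simp_all add: z z[unfolded One_nat_def] s_def t_def)
  define D where "D = s 2 2 * s 3 3 - s 2 3 * s 3 2"
  have "D * (t 2 2 * t 3 3 - t 2 3 * t 3 2) =
      (s 2 2 * t 2 2 + s 2 3 * t 3 2) * (s 3 2 * t 2 3 + s 3 3 * t 3 3) -
      (s 2 2 * t 2 3 + s 2 3 * t 3 3) * (s 3 2 * t 2 2 + s 3 3 * t 3 2)"
    unfolding D_def by (simp add: algebra_simps)
  hence D: "D * (t 2 2 * t 3 3 - t 2 3 * t 3 2) = 1"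
    by (simp add: eq)
  have "D * t 2 j = s 3 3 * (s 2 2 * t 2 j + s 2 3 * t 3 j) - s 2 3 * (s 3 2 * t 2 j + s 3 3 * t 3 j)"
    "D * t 3 j = s 2 2 * (s 3 2 * t 2 j + s 3 3 * t 3 j) - s 3 2 * (s 2 2 * t 2 j + s 2 3 * t 3 j)"
    unfolding D_def by (simp_all add: algebra_simps)
  hence "D * t 2 j = 0" "D * t 3 j = 0"
    using j by (auto simp: eq)
  hence "D * t i j = 0" using i by auto
  hence "(D * (t 2 2 * t 3 3 - t 2 3 * t 3 2)) * t i j = 0"
    by (metis mult.assoc mult.commute mult_zero_right)
  hence "t i j = 0" by (simp only: D mult_1_left)
  thus ?thesis by (simp add: t_def)
qed

lemma U_geomI:
  assumes u: "u \<in> carrier_mat (i + j) (i + j)"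
    and *: "\<And>k l. k < i + j \<Longrightarrow> l < i + j \<Longrightarrow> k \<ge> i \<or> l < i \<Longrightarrow> u $$ (k, l) = (if k = l then 1 else 0)"
  shows "u \<in> U_geom i j"
proof -
  have "u = four_block_mat (1\<^sub>m i) (mat i j (\<lambda>(k, l). u $$ (k, l + i))) (0\<^sub>m j i) (1\<^sub>m j)"
    by (rule eq_matI) (use u in \<open>auto simp: *\<close>)
  thus ?thesis unfolding U_geom_def by (intro CollectI exI conjI) auto
qed

lemma det_U_geom:
  assumes "u \<in> U_geom i j"
  shows "det u = 1"
proof -
  obtain B where B: "B \<in> carrier_mat i j" "u = four_block_mat (1\<^sub>m i) B (0\<^sub>m j i) (1\<^sub>m j)"
    using assms by (auto simp: U_geom_def)
  have u: "u \<in> carrier_mat (i + j) (i + j)" using B by auto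
  have "upper_triangular u" using B by (auto simp: upper_triangular_def)
  hence "det u = prod_list (diag_mat u)" by (rule det_upper_triangular[OF _ u])
  also have "diag_mat u = replicate (i + j) 1"
    by (rule nth_equalityI) (use u B in \<open>auto simp: diag_mat_def\<close>)
  finally show ?thesis by simp
qed

text \<open>All three partitions end in \<open>1\<close>, so the last coordinate of a vector in \<open>M\<^sub>\<lambda>\<close> lies in
  \<open>\<pp>/\<pp>\<^sup>2\<close> and is killed by \<open>\<varpi>\<close>.\<close>

lemma addrow_mat_U_inf:
  assumes i: "i < 3" and l: "l ! 3 = 1"
  shows "addrow_mat 4 (uniformizer * x) i 3 \<in> U_inf l"
proof -
  let ?u = "addrow_mat 4 (uniformizer * x) i 3"
  have fixes_M: "?u *\<^sub>v v = v" if v: "v \<in> M_sub l" for v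
  proof (rule eq_vecI)
    have vc: "v \<in> carrier_vec 4" and "v $ 3 \<in> to_intring2 ` pideal (2 - l ! 3)"
      using v by (simp_all add: M_sub_def)
    hence "reduce (v $ 3) = 0"
      by (auto simp: l reduce_to_intring2_eq_0_iff)
    hence v3: "uniformizer * x * v $ 3 = 0"
      by (intro reduce_mult_eq_0) auto
    show "dim_vec (?u *\<^sub>v v) = dim_vec v" using vc by simp
    fix r assume "r < dim_vec v"
    hence r: "r < 4" using vc by simp
    have "(?u *\<^sub>v v) $ r = (\<Sum>c<4. ?u $$ (r, c) * v $ c)"
      using r vc by (simp add: scalar_prod_def lessThan_atLeast0)
    also have "\<dots> = (\<Sum>c<4. (if c = r then v $ r else 0) + (if c = 3 then if r = i then uniformizer * x * v $ 3 else 0 else 0))"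
      using r i by (intro sum.cong) (auto simp: algebra_simps)
    also have "\<dots> = v $ r"
      using r by (simp add: sum.distrib v3)
    finally show "(?u *\<^sub>v v) $ r = v $ r" .
  qed
  moreover have "?u \<in> carrier (GL 4)"
    using addrow_mat_K1[of i 3 x] i by (simp add: K1_eq)
  ultimately show ?thesis
    by (simp add: U_inf_def P_inf_def)
qed

lemma hom_units_one:
  fixes \<chi> :: "'r :: comm_ring_1 \<Rightarrow> complex"
  assumes "\<chi> \<in> hom (units_of (class_ring :: 'r ring)) (units_of (class_ring :: complex ring))"
  shows "\<chi> 1 = 1"
proof -
  have 1: "(1 :: 'r) \<in> carrier (units_of class_ring)"
    by (auto simp: units_of_def Units_def class_ring_simps)
  have "\<chi> 1 \<in> Units (class_ring :: complex ring)"
    using hom_in_carrier[OF assms 1] by (simp add: units_of_def)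
  hence "\<chi> 1 \<noteq> 0" by (auto simp: Units_def class_ring_simps)
  moreover have "\<chi> (1 * 1) = \<chi> 1 * \<chi> 1"
    using hom_mult[OF assms 1 1] by (simp add: units_of_def class_ring_simps)
  ultimately show ?thesis by simp
qed

lemma fixed_vector_untwist:
  fixes \<rho> :: "'r :: comm_ring_1 mat \<Rightarrow> complex mat"
  assumes \<chi>: "\<chi> \<in> hom (units_of (class_ring :: 'r ring)) (units_of (class_ring :: complex ring))"
    and fixed: "has_fixed_vector U n (\<lambda>g. \<chi> (det g) \<cdot>\<^sub>m \<rho> g)"
  obtains v where "v \<in> carrier_vec n" "v \<noteq> 0\<^sub>v n"
    "\<forall>u\<in>U. u \<in> carrier (GL m) \<longrightarrow> det u = 1 \<longrightarrow> \<rho> u *\<^sub>v v = v"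
proof -
  obtain v where v: "v \<in> carrier_vec n" "v \<noteq> 0\<^sub>v n" "\<forall>u\<in>U. (\<chi> (det u) \<cdot>\<^sub>m \<rho> u) *\<^sub>v v = v"
    using fixed by (auto simp: has_fixed_vector_def)
  have "\<rho> u *\<^sub>v v = v" if "u \<in> U" "u \<in> carrier (GL m)" "det u = 1" for u
  proof -
    have "1 \<cdot>\<^sub>m \<rho> u = \<rho> u" by (rule eq_matI) auto
    thus ?thesis using v(3) that hom_units_one[OF \<chi>] by force
  qed
  thus ?thesis using that v(1,2) by blast
qed

section \<open>The extended character on conjugates of unipotent subgroups\<close>

context
  fixes \<psi> :: "'a :: nonarch_local_field intring \<Rightarrow> complex" and d :: "'a intring2"
  assumes \<psi>: "additive_char_conductor_p2 \<psi>"
    and d: "\<And>x. x * x - x \<noteq> reduce d"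
begin

definition theta :: "'a intring2 mat \<Rightarrow> complex" where
  "theta h = char_on_intring2 \<psi> (theta_exponent d h)"

lemma theta_mult: "h \<in> unipotent_preimage \<Longrightarrow> k \<in> unipotent_preimage \<Longrightarrow> theta (h * k) = theta h * theta k"
  by (simp add: theta_def theta_exponent_mult char_on_intring2_add[OF \<psi>])

lemma theta_nonzero: "theta h \<noteq> 0"
  by (simp add: theta_def char_on_intring2_nonzero[OF \<psi>])

lemma theta_unipotent: "theta (unipotent a) = char_on_intring2 \<psi> (uniformizer * a)"
  by (simp add: theta_def theta_exponent_def unipotent_index)

lemma theta_K1:
  assumes "k \<in> K1"
  shows "psi_char \<psi> (orbit_mat (reduce d)) k = theta k"
proof -
  let ?P = "\<lambda>B. B \<in> carrier_mat 4 4 \<and> map_mat reduce B = orbit_mat (reduce d)"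
  have "?P (orbit_mat d)" by (simp add: reduce.orbit_mat_hom)
  hence "?P (SOME B. ?P B)" by (rule someI)
  thus ?thesis using trace_K1[OF assms, of "SOME B. ?P B" d]
    by (simp add: psi_char_def theta_def)
qed

lemma conj_entry_eq_0:
  assumes g: "g \<in> carrier (GL 4)" and ij: "i < 4" "j < 4" "i \<noteq> j"
    and triv: "\<And>x. theta (g * addrow_mat 4 (uniformizer * x) i j * inv\<^bsub>GL 4\<^esub> g) = 1"
  shows "map_mat reduce (inv\<^bsub>GL 4\<^esub> g * orbit_mat d * g) $$ (j, i) = 0"
proof -
  let ?M = "inv\<^bsub>GL 4\<^esub> g * orbit_mat d * g"
  have M: "?M \<in> carrier_mat 4 4"
    by (intro mult_carrier_mat[of _ 4 4] inv_GL(1)[OF g] orbit_mat_carrier carrier_GL_carrier_mat[OF g])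
  have "reduce (?M $$ (j, i)) = 0"
    using triv by (intro reduce_eq_0_if_char_trivial[OF \<psi>])
      (simp only: theta_def theta_exponent_conj_addrow_mat[OF g ij])
  thus ?thesis using M ij by (simp only: index_map_mat carrier_matD[OF M])
qed

text \<open>Triviality would make the last row of \<open>g\<^sup>-\<^sup>1\<close> a left eigenvector of \<open>\<beta>\<close> modulo \<open>\<pp>\<close>.\<close>

lemma theta_nontrivial_on_last_column:
  assumes g: "g \<in> carrier (GL 4)"
  shows "\<exists>i<3. \<exists>x. theta (g * addrow_mat 4 (uniformizer * x) i 3 * inv\<^bsub>GL 4\<^esub> g) \<noteq> 1"
proof (rule ccontr)
  assume *: "\<not> ?thesis"
  let ?h = "inv\<^bsub>GL 4\<^esub> g"
  note h = inv_GL[OF g] and gc = carrier_GL_carrier_mat[OF g]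
  let ?M = "map_mat reduce (?h * orbit_mat d * g)"
  have M: "?M \<in> carrier_mat 4 4"
    by (simp only: map_carrier_mat) (intro mult_carrier_mat[of _ 4 4] h orbit_mat_carrier gc)
  have "?M $$ (3, i) = 0" if "i < 3" for i
    using * that by (intro conj_entry_eq_0[OF g]) auto
  hence zero: "?M $$ (3, 0) = 0" "?M $$ (3, 1) = 0" "?M $$ (3, 2) = 0" by simp_all
  have "map_mat reduce ?h $$ (3, i) = 0" if "i < 4" for i
    by (rule orbit_mat_no_left_eigenvector[OF d _ M reduce_conj(2)[OF g] zero that]) (use h in simp)
  hence "(map_mat reduce ?h * map_mat reduce g) $$ (3, 3) = 0"
    using h(1) gc by (subst index_mult_mat_4) simp_all
  thus False
    by (simp add: map_reduce_mult[OF h(1) gc, symmetric] h(3) reduce.mat_hom_one)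
qed

text \<open>Triviality would make the first column of \<open>g\<close> an eigenvector of \<open>\<beta>\<close> modulo \<open>\<pp>\<close>.\<close>

lemma theta_nontrivial_on_first_row:
  assumes g: "g \<in> carrier (GL 4)"
  shows "\<exists>j<4. j \<noteq> 0 \<and> (\<exists>x. theta (g * addrow_mat 4 (uniformizer * x) 0 j * inv\<^bsub>GL 4\<^esub> g) \<noteq> 1)"
proof (rule ccontr)
  assume *: "\<not> ?thesis"
  let ?h = "inv\<^bsub>GL 4\<^esub> g"
  note h = inv_GL[OF g] and gc = carrier_GL_carrier_mat[OF g]
  let ?M = "map_mat reduce (?h * orbit_mat d * g)"
  have M: "?M \<in> carrier_mat 4 4"
    by (simp only: map_carrier_mat) (intro mult_carrier_mat[of _ 4 4] h orbit_mat_carrier gc)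
  have "?M $$ (j, 0) = 0" if "j < 4" "j \<noteq> 0" for j
    using * that by (intro conj_entry_eq_0[OF g]) auto
  hence zero: "?M $$ (1, 0) = 0" "?M $$ (2, 0) = 0" "?M $$ (3, 0) = 0" by simp_all
  have "map_mat reduce g $$ (i, 0) = 0" if "i < 4" for i
    by (rule orbit_mat_no_eigenvector[OF d _ M reduce_conj(1)[OF g] zero that]) (use gc in simp)
  hence "(map_mat reduce ?h * map_mat reduce g) $$ (0, 0) = 0"
    using h(1) gc by (subst index_mult_mat_4) simp_all
  thus False
    by (simp add: map_reduce_mult[OF h(1) gc, symmetric] h(3) reduce.mat_hom_one)
qed

lemma reduce_block_upper:
  assumes g: "g \<in> carrier (GL 4)"
    and triv: "\<And>i j x. i < 2 \<Longrightarrow> j \<in> {2, 3} \<Longrightarrow> theta (g * addrow_mat 4 (uniformizer * x) i j * inv\<^bsub>GL 4\<^esub> g) = 1"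
    and ij: "i \<in> {2, 3}" "j < 2"
  shows "reduce (g $$ (i, j)) = 0"
proof -
  let ?h = "inv\<^bsub>GL 4\<^esub> g"
  note h = inv_GL[OF g] and gc = carrier_GL_carrier_mat[OF g]
  let ?M = "map_mat reduce (?h * orbit_mat d * g)"
  have M: "?M \<in> carrier_mat 4 4"
    by (simp only: map_carrier_mat) (intro mult_carrier_mat[of _ 4 4] h orbit_mat_carrier gc)
  have "?M $$ (j, i) = 0" if "i < 2" "j \<in> {2, 3}" for i j
    using triv[OF that] that by (intro conj_entry_eq_0[OF g]) auto
  hence zero: "?M $$ (2, 0) = 0" "?M $$ (2, 1) = 0" "?M $$ (3, 0) = 0" "?M $$ (3, 1) = 0" by simp_all
  have "map_mat reduce g $$ (2, 0) = 0 \<and> map_mat reduce g $$ (2, 1) = 0 \<and>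
      map_mat reduce g $$ (3, 0) = 0 \<and> map_mat reduce g $$ (3, 1) = 0"
    by (rule orbit_mat_invariant_plane[OF d _ M reduce_conj(1)[OF g] zero]) (use gc in simp)
  moreover have "j = 0 \<or> j = 1" using ij by auto
  ultimately show ?thesis using ij gc by auto
qed

text \<open>If \<open>\<theta>\<close> is nontrivial on a conjugate \<open>g (1 + \<varpi> x E\<^sub>i\<^sub>j) g\<^sup>-\<^sup>1\<close> there is nothing to do. Otherwise \<open>g\<close> is
  block upper triangular modulo \<open>\<pp>\<close>, and after multiplication by some \<open>k \<in> K\<^sub>1\<close> it is so exactly. Conjugation by the
  resulting \<open>p\<close> preserves \<open>U\<^sub>2\<^sub>,\<^sub>2\<close>, so \<open>p\<^sup>-\<^sup>1 (1 + a N) p\<close> is an element of \<open>U\<^sub>2\<^sub>,\<^sub>2\<close>; and since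
  \<open>k\<close> lies in the domain \<open>H\<close> of the character \<open>\<theta>\<close>, conjugation by \<open>k\<close> does not change the value of \<open>\<theta>\<close>.\<close>

lemma theta_nontrivial_on_block:
  assumes g: "g \<in> carrier (GL 4)"
  shows "\<exists>u\<in>U_geom 2 2 \<inter> carrier (GL 4). g * u * inv\<^bsub>GL 4\<^esub> g \<in> unipotent_preimage \<and> theta (g * u * inv\<^bsub>GL 4\<^esub> g) \<noteq> 1"
proof (cases "\<forall>i j x. i < 2 \<longrightarrow> j \<in> {2, 3} \<longrightarrow> theta (g * addrow_mat 4 (uniformizer * x) i j * inv\<^bsub>GL 4\<^esub> g) = 1")
  case False
  then obtain i j x where ij: "i < 2" "j \<in> {2, 3}" "theta (g * addrow_mat 4 (uniformizer * x) i j * inv\<^bsub>GL 4\<^esub> g) \<noteq> 1"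
    by blast
  let ?u = "addrow_mat 4 (uniformizer * x) i j"
  have "?u \<in> U_geom 2 2" using ij by (intro U_geomI) auto
  moreover have "?u \<in> K1" using ij by (intro addrow_mat_K1) auto
  ultimately show ?thesis
    using ij(3) K1_normal[OF g] K1_subset_unipotent_preimage K1_eq by blast
next
  case True
  let ?h = "inv\<^bsub>GL 4\<^esub> g"
  note h = inv_GL[OF g] and gc = carrier_GL_carrier_mat[OF g]
  have red0: "reduce (g $$ (i, j)) = 0" if "i \<in> {2, 3}" "j < 2" for i j
    using True by (intro reduce_block_upper[OF g _ that]) blast
  \<comment> \<open>setting the lower left block of \<open>g\<close> to zero does not change \<open>g\<close> modulo \<open>\<pp>\<close>, so \<open>p g\<^sup>-\<^sup>1 \<in> K\<^sub>1\<close>\<close>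
  define p where "p = mat 4 4 (\<lambda>(i, j). if i \<in> {2, 3} \<and> j < 2 then 0 else g $$ (i, j))"
  have pc: "p \<in> carrier_mat 4 4" by (simp add: p_def)
  have p0: "p $$ (i, j) = 0" if "i \<in> {2, 3}" "j \<in> {0, 1}" for i j
    using that by (auto simp: p_def)
  have "map_mat reduce p = map_mat reduce g"
    by (rule eq_matI) (use gc red0 in \<open>auto simp: p_def\<close>)
  define k where "k = p * ?h"
  have kc: "k \<in> carrier_mat 4 4" unfolding k_def by (rule mult_carrier_mat[OF pc h(1)])
  have "map_mat reduce k = map_mat reduce (g * ?h)"
    by (simp add: k_def map_reduce_mult[OF pc h(1)] map_reduce_mult[OF gc h(1)] \<open>map_mat reduce p = _\<close>)
  hence k: "k \<in> K1"
    using kc by (intro K1I) (simp_all add: h reduce.mat_hom_one)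
  hence kG: "k \<in> carrier (GL 4)" and kH: "k \<in> unipotent_preimage"
    using K1_subset_unipotent_preimage by (auto simp: K1_eq)
  have p: "p = k * g"
    unfolding k_def by (simp add: assoc_mult_mat[OF pc h(1) gc] h right_mult_one_mat[OF pc])
  interpret GL: group "GL 4 :: 'a intring2 mat monoid" by (rule group_GL)
  have pG: "p \<in> carrier (GL 4)"
    using GL.m_closed[OF kG g] by (simp add: p)
  let ?q = "inv\<^bsub>GL 4\<^esub> p"
  note q = inv_GL[OF pG]
  have q0: "?q $$ (i, j) = 0" if "i \<in> {2, 3}" "j \<in> {0, 1}" for i j
    by (rule block_upper_inverse[OF pc q(1,2) p0 that])
  obtain a where a: "char_on_intring2 \<psi> (uniformizer * a) \<noteq> 1"
    using char_on_intring2_nontrivial[OF \<psi>] by blast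
  define u where "u = ?q * (unipotent a * p)"
  note upc = mult_carrier_mat[OF unipotent_carrier[of a] pc]
  have uc: "u \<in> carrier_mat 4 4"
    unfolding u_def by (rule mult_carrier_mat[OF q(1) upc])
  have up: "(unipotent a * p) $$ (r, l) = p $$ (r, l) + (if r = 0 then a * p $$ (2, l) else if r = 1 then a * p $$ (3, l) else 0)"
    if "r < 4" "l < 4" for r l
    unfolding index_mult_mat_4[OF unipotent_carrier pc that]
    using that(1) unfolding less_4_iff by (elim disjE) (simp_all add: unipotent_index)
  have u_entry: "u $$ (i, j) = (if i = j then 1 else 0)" if ij: "i < 4" "j < 4" "i \<ge> 2 \<or> j < 2" for i j
  proof -
    have "(if i = j then 1 else 0) = (?q * p) $$ (i, j)"
      using ij by (simp add: q(3))
    also have "\<dots> = ?q $$ (i, 0) * p $$ (0, j) + ?q $$ (i, 1) * p $$ (1, j) +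
        ?q $$ (i, 2) * p $$ (2, j) + ?q $$ (i, 3) * p $$ (3, j)"
      by (rule index_mult_mat_4[OF q(1) pc ij(1,2)])
    finally have *: "?q $$ (i, 0) * p $$ (0, j) + ?q $$ (i, 1) * p $$ (1, j) +
        ?q $$ (i, 2) * p $$ (2, j) + ?q $$ (i, 3) * p $$ (3, j) = (if i = j then 1 else 0)" by simp
    have "?q $$ (i, 0) * (a * p $$ (2, j)) = 0 \<and> ?q $$ (i, 1) * (a * p $$ (3, j)) = 0"
    proof (cases "j < 2")
      case True
      hence "j \<in> {0, 1}" by auto
      thus ?thesis by (simp add: p0)
    next
      case False
      hence "i \<in> {2, 3}" using ij by auto
      thus ?thesis by (simp add: q0)
    qed
    thus ?thesis
      using * unfolding u_def index_mult_mat_4[OF q(1) upc ij(1,2)]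
      by (simp add: up ij(2) distrib_left algebra_simps)
  qed
  have "u \<in> U_geom 2 2"
    by (rule U_geomI) (use uc u_entry in simp_all)
  moreover have uG: "u \<in> carrier (GL 4)"
    using GL.m_closed[OF GL.inv_closed[OF pG] GL.m_closed[OF unipotent_GL pG]] by (simp add: u_def)
  moreover have conj: "g * u * ?h = inv\<^bsub>GL 4\<^esub> k * unipotent a * k"
  proof -
    have "inv\<^bsub>GL 4\<^esub> k \<otimes>\<^bsub>GL 4\<^esub> unipotent a \<otimes>\<^bsub>GL 4\<^esub> k =
        g \<otimes>\<^bsub>GL 4\<^esub> (inv\<^bsub>GL 4\<^esub> (k \<otimes>\<^bsub>GL 4\<^esub> g) \<otimes>\<^bsub>GL 4\<^esub> (unipotent a \<otimes>\<^bsub>GL 4\<^esub> (k \<otimes>\<^bsub>GL 4\<^esub> g))) \<otimes>\<^bsub>GL 4\<^esub> ?h"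
    proof -
      have "g \<otimes>\<^bsub>GL 4\<^esub> inv\<^bsub>GL 4\<^esub> (k \<otimes>\<^bsub>GL 4\<^esub> g) = inv\<^bsub>GL 4\<^esub> k"
        using g kG by (simp add: GL.inv_mult_group GL.m_assoc [symmetric] del: mult_GL one_GL)
      moreover have "k \<otimes>\<^bsub>GL 4\<^esub> g \<otimes>\<^bsub>GL 4\<^esub> ?h = k"
        using g kG by (simp add: GL.m_assoc del: mult_GL one_GL)
      ultimately show ?thesis
        using g kG unipotent_GL[of a] pG
        by (metis GL.inv_closed GL.m_assoc GL.m_closed)
    qed
    thus ?thesis by (simp add: u_def p)
  qed
  moreover have kH': "inv\<^bsub>GL 4\<^esub> k \<in> unipotent_preimage"
    by (rule subgroup.m_inv_closed[OF subgroup_unipotent_preimage kH])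
  have uH: "unipotent a \<in> unipotent_preimage"
  proof (rule unipotent_preimageI[OF unipotent_GL])
    show "map_mat reduce (unipotent a) = unipotent (reduce a)"
      by (rule eq_matI) (auto simp: unipotent_def)
  qed
  have kuH: "inv\<^bsub>GL 4\<^esub> k * unipotent a \<in> unipotent_preimage"
    using subgroup.m_closed[OF subgroup_unipotent_preimage kH' uH] by simp
  moreover have "inv\<^bsub>GL 4\<^esub> k * unipotent a * k \<in> unipotent_preimage"
    using subgroup.m_closed[OF subgroup_unipotent_preimage kuH kH] by simp
  moreover have "theta (inv\<^bsub>GL 4\<^esub> k * unipotent a * k) = theta (inv\<^bsub>GL 4\<^esub> k * k) * theta (unipotent a)"
    by (simp only: theta_mult kuH kH kH' uH mult_ac)
  moreover have "theta (inv\<^bsub>GL 4\<^esub> k * k) = 1"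
    by (simp only: inv_GL[OF kG] unipotent_0 [symmetric] theta_unipotent mult_zero_right)
      (use char_on_intring2_add[OF \<psi>, of 0 0] char_on_intring2_nonzero[OF \<psi>, of 0] in simp)
  ultimately show ?thesis
    using a by (intro bexI[of _ u]) (simp_all add: theta_unipotent)
qed

end

section \<open>Cuspidality\<close>

theorem mainTheorem1:
  fixes \<psi> :: "'a :: nonarch_local_field intring \<Rightarrow> complex"
  assumes "additive_char_conductor_p2 \<psi>"
  shows "\<exists>n (\<rho> :: 'a intring2 mat \<Rightarrow> complex mat).
    irreducible_rep (GL 4) n \<rho> \<and> cuspidal n \<rho> \<and> \<not> strongly_cuspidal \<psi> n \<rho>"
proof -
  obtain d0 :: "'a resfield" where d0: "\<And>x. x * x - x \<noteq> d0"
    using ex_quadratic_without_roots by blast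
  obtain d :: "'a intring2" where "d0 = reduce d" by (rule reduce_surj)
  hence d: "\<And>x. x * x - x \<noteq> reduce d" using d0 by simp
  note \<psi> = assms
  let ?G = "GL 4 :: 'a intring2 mat monoid"
  let ?\<theta> = "theta \<psi> d"
  have fin: "finite (carrier ?G)"
    using finite_carrier_mat[OF finite_UNIV_intring2, of 4 4]
    by (rule finite_subset[rotated]) (auto simp: carrier_GL)
  obtain n \<rho> where irr: "irreducible_rep ?G n \<rho>"
    and eigen: "\<exists>v\<in>carrier_vec n. v \<noteq> 0\<^sub>v n \<and> (\<forall>h\<in>unipotent_preimage. \<rho> h *\<^sub>v v = ?\<theta> h \<cdot>\<^sub>v v)"
    and fixed: "\<And>v. v \<in> carrier_vec n \<Longrightarrow> v \<noteq> 0\<^sub>v n \<Longrightarrow> \<exists>g\<in>carrier ?G. \<forall>u\<in>carrier ?G.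
        \<rho> u *\<^sub>v v = v \<longrightarrow> g * u * inv\<^bsub>?G\<^esub> g \<in> unipotent_preimage \<longrightarrow> ?\<theta> (g * u * inv\<^bsub>?G\<^esub> g) = 1"
    by (rule ex_irreducible_rep_of_character[OF group_GL fin subgroup_unipotent_preimage, of ?\<theta>, unfolded mult_GL])
      (simp_all add: theta_mult[OF \<psi> d] theta_nonzero[OF \<psi> d])
  have not_fixed: "\<not> has_fixed_vector U n (\<lambda>g. \<chi> (det g) \<cdot>\<^sub>m \<rho> g)"
    if \<chi>: "\<chi> \<in> hom (units_of (class_ring :: 'a intring2 ring)) (units_of (class_ring :: complex ring))"
      and U: "\<And>g. g \<in> carrier ?G \<Longrightarrow> \<exists>u\<in>U. u \<in> carrier ?G \<and> det u = 1 \<and>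
        g * u * inv\<^bsub>?G\<^esub> g \<in> unipotent_preimage \<and> ?\<theta> (g * u * inv\<^bsub>?G\<^esub> g) \<noteq> 1" for \<chi> U
  proof
    assume "has_fixed_vector U n (\<lambda>g. \<chi> (det g) \<cdot>\<^sub>m \<rho> g)"
    then obtain v where v: "v \<in> carrier_vec n" "v \<noteq> 0\<^sub>v n"
      "\<forall>u\<in>U. u \<in> carrier ?G \<longrightarrow> det u = 1 \<longrightarrow> \<rho> u *\<^sub>v v = v"
      by (rule fixed_vector_untwist[OF \<chi>])
    obtain g where "g \<in> carrier ?G" "\<forall>u\<in>carrier ?G. \<rho> u *\<^sub>v v = v \<longrightarrow>
        g * u * inv\<^bsub>?G\<^esub> g \<in> unipotent_preimage \<longrightarrow> ?\<theta> (g * u * inv\<^bsub>?G\<^esub> g) = 1"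
      using fixed[OF v(1,2)] by blast
    thus False using U[of g] v(3) by blast
  qed
  have K1_conj: "addrow_mat 4 (uniformizer * x) i j \<in> carrier ?G \<and> det (addrow_mat 4 (uniformizer * x) i j) = 1 \<and>
      g * addrow_mat 4 (uniformizer * x) i j * inv\<^bsub>?G\<^esub> g \<in> unipotent_preimage"
    if "g \<in> carrier ?G" "i \<noteq> j" for g i j x
    using K1_normal[OF that(1) addrow_mat_K1[OF that(2)], of x] K1_subset_unipotent_preimage
      addrow_mat_K1[OF that(2), of x] det_addrow_mat[OF that(2)] by (auto simp: K1_eq)
  have last_column: "\<exists>u\<in>U. u \<in> carrier ?G \<and> det u = 1 \<and>
        g * u * inv\<^bsub>?G\<^esub> g \<in> unipotent_preimage \<and> ?\<theta> (g * u * inv\<^bsub>?G\<^esub> g) \<noteq> 1"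
    if U: "\<And>i x. i < 3 \<Longrightarrow> addrow_mat 4 (uniformizer * x) i 3 \<in> U" and g: "g \<in> carrier ?G" for U g
  proof -
    obtain i x where "i < 3" "?\<theta> (g * addrow_mat 4 (uniformizer * x) i 3 * inv\<^bsub>?G\<^esub> g) \<noteq> 1"
      using theta_nontrivial_on_last_column[OF \<psi> d g] by blast
    thus ?thesis using K1_conj[OF g, of i 3 x] U by blast
  qed
  have geom_13: "\<exists>u\<in>U_geom 1 3. u \<in> carrier ?G \<and> det u = 1 \<and>
        g * u * inv\<^bsub>?G\<^esub> g \<in> unipotent_preimage \<and> ?\<theta> (g * u * inv\<^bsub>?G\<^esub> g) \<noteq> 1" if g: "g \<in> carrier ?G" for g
  proof -
    obtain j x where j: "j < 4" "j \<noteq> 0" "?\<theta> (g * addrow_mat 4 (uniformizer * x) 0 j * inv\<^bsub>?G\<^esub> g) \<noteq> 1"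
      using theta_nontrivial_on_first_row[OF \<psi> d g] by blast
    moreover have "addrow_mat 4 (uniformizer * x) 0 j \<in> U_geom 1 3"
      using j by (intro U_geomI) auto
    ultimately show ?thesis using K1_conj[OF g, of 0 j x] by blast
  qed
  have geom_22: "\<exists>u\<in>U_geom 2 2. u \<in> carrier ?G \<and> det u = 1 \<and>
        g * u * inv\<^bsub>?G\<^esub> g \<in> unipotent_preimage \<and> ?\<theta> (g * u * inv\<^bsub>?G\<^esub> g) \<noteq> 1" if g: "g \<in> carrier ?G" for g
    using theta_nontrivial_on_block[OF \<psi> d g] det_U_geom by blast
  have "cuspidal n \<rho>"
    unfolding cuspidal_def
  proof (intro ballI conjI)
    fix \<chi> assume \<chi>: "\<chi> \<in> hom (units_of (class_ring :: 'a intring2 ring)) (units_of (class_ring :: complex ring))"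
    have "addrow_mat 4 (uniformizer * x) i 3 \<in> U_geom 3 1" if "i < 3" for i and x :: "'a intring2"
      using that by (intro U_geomI) auto
    hence geom_31: "\<not> has_fixed_vector (U_geom 3 1) n (\<lambda>g. \<chi> (det g) \<cdot>\<^sub>m \<rho> g)"
      by (intro not_fixed[OF \<chi>] last_column)
    show "case ij of (i, j) \<Rightarrow> \<not> has_fixed_vector (U_geom i j) n (\<lambda>g. \<chi> (det g) \<cdot>\<^sub>m \<rho> g)"
      if "ij \<in> {(1, 3), (2, 2), (3, 1)}" for ij
      using that geom_31 not_fixed[OF \<chi> geom_13] not_fixed[OF \<chi> geom_22] by auto
    show "\<not> has_fixed_vector (U_inf l) n (\<lambda>g. \<chi> (det g) \<cdot>\<^sub>m \<rho> g)"
      if "l \<in> {[2, 1, 1, 1], [2, 2, 1, 1], [2, 2, 2, 1]}" for l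
      using that by (intro not_fixed[OF \<chi>] last_column addrow_mat_U_inf) auto
  qed
  moreover have "orbit_mat (reduce d) \<in> rep_orbit \<psi> n \<rho>"
  proof -
    obtain v where "v \<in> carrier_vec n" "v \<noteq> 0\<^sub>v n" "\<forall>h\<in>unipotent_preimage. \<rho> h *\<^sub>v v = ?\<theta> h \<cdot>\<^sub>v v"
      using eigen by blast
    hence "\<forall>x\<in>K1. \<rho> x *\<^sub>v v = psi_char \<psi> (orbit_mat (reduce d)) x \<cdot>\<^sub>v v"
      using K1_subset_unipotent_preimage by (auto simp: theta_K1[OF \<psi> d])
    thus ?thesis
      using \<open>v \<in> _\<close> \<open>v \<noteq> _\<close> by (auto simp: rep_orbit_def)
  qed
  hence "\<not> strongly_cuspidal \<psi> n \<rho>"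
    using not_irreducible_char_poly_orbit_mat[of "reduce d"] by (auto simp: strongly_cuspidal_def)
  ultimately show ?thesis using irr by blast
qed

end
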